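(* Let $f:\mathbb{R}^n\to\mathbb{R}$ be continuously differentiable, let $\varphi:\mathbb{R}^n\to(-\infty,+\infty]$ be convex, lower semicontinuous and proper, and let $\psi=f+\varphi$. Let the random process $(\mathsf X^k)_k$ be generated by the stochastic extra-step method described in the context, using parameter matrices $\Lambda_k=\lambda_k^{-1}I$ and $\Lambda_{k,+}=\lambda_{k,+}^{-1}I$ with $\lambda_k,\lambda_{k,+}>0$. Suppose: (A.1) $\nabla f$ is Lipschitz continuous on $\mathbb{R}^n$ with modulus $L_f\ge 1$; (A.2) $\psi$ is bounded from below on $\mathrm{dom}\,\varphi$; (B.1) $\mathsf D^k:\Omega\to\mathbb{R}^n$ is $\mathcal F^k$-measurable for all $k$; (B.2) for all $k$ there is $\nu_k>0$ such that $\mathbb{E}[\|\mathsf D^k\|^2\mid\mathcal F_+^{k-1}]\le\nu_k^2\cdot\mathbb{E}[\|F^{\Lambda_k}_{\mathsf V^k}(\mathsf X^k)\|^2\mid\mathcal F_+^{k-1}]$ a.e.; (B.3) for all $k$ it holds that $\mathbb{E}[\mathsf V^k\mid\mathcal F_+^{k-1}]=\nabla f(\mathsf X^k)$ and $\mathbb{E}[\mathsf V_+^k\mid\mathcal F^k]=\nabla f(\mathsf Z^k)$ a.e., and there are $\sigma_k,\sigma_{k,+}>0$ such that a.e. $$\mathbb{E}[\|\nabla f(\mathsf X^k)-\mathsf V^k\|^2\mid\mathcal F_+^{k-1}]\le\sigma_k^2,\qquad \mathbb{E}[\|\nabla f(\mathsf Z^k)-\mathsf V_+^k\|^2\mid\mathcal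 F^k]\le\sigma_{k,+}^2 .$$ Assume that there are $\bar\rho,\underline\rho\in(0,1)$ such that for all $k$ $$\lambda_{k,+}\le\frac{1-\bar\rho}{L_f},\qquad \lambda_k\le\frac{(1-\bar\rho)\lambda_{k,+}}{1+\nu_k^2(\alpha_k+L_f\beta_k\lambda_{k,+})^2},\qquad \underline\rho\,\lambda_{k,+}\le\lambda_k,$$ and that $$\sum_k\lambda_k=\infty,\qquad \sum_k\lambda_k\sigma_k^2<\infty,\qquad \sum_k\lambda_{k,+}\sigma_{k,+}^2<\infty .$$ Then $\lim_{k\to\infty}\mathbb{E}[\|F^I(\mathsf X^k)\|]=0$ and $\lim_{k\to\infty}F^I(\mathsf X^k)=0$ almost surely.
   Context: $\|\cdot\|$ is the Euclidean norm. For a symmetric positive definite matrix $\Lambda\in\mathbb{R}^{n\times n}$ let $\|x\|_\Lambda=\sqrt{\langle x,\Lambda x\rangle}$ and $\mathrm{prox}^\Lambda_\varphi(x)=\mathrm{argmin}_y\ \varphi(y)+\frac12\|x-y\|_\Lambda^2$. For $v\in\mathbb{R}^n$, $F^\Lambda_v(x):=x-\mathrm{prox}^\Lambda_\varphi(x-\Lambda^{-1}v)$ and $F^\Lambda(x):=F^\Lambda_{\nabla f(x)}(x)$; $F^I$ is the case $\Lambda=I$ (identity). Stochastic extra-step method: let $(\Omega,\mathcal F,\mathbb P)$ be a probability space, $x^0\in\mathrm{dom}\,\varphi$ deterministic, $(\alpha_k)_k,(\beta_k)_k$ deterministic nonnegative step sizes, $(\lambda_k)_k,(\lambda_{k,+})_k$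 deterministic positive numbers. Set $\mathsf X^0=x^0$ and for $k=0,1,2,\dots$: given a random vector $\mathsf V^k:\Omega\to\mathbb{R}^n$ (stochastic approximation of $\nabla f(\mathsf X^k)$), choose a random direction $\mathsf D^k:\Omega\to\mathbb{R}^n$ and set $\mathsf Z^k=\mathsf X^k+\beta_k\mathsf D^k$; given a random vector $\mathsf V_+^k:\Omega\to\mathbb{R}^n$ (stochastic approximation of $\nabla f(\mathsf Z^k)$), set $$\mathsf X^{k+1}=\mathrm{prox}^{\Lambda_{k,+}}_\varphi\big(\mathsf X^k+\alpha_k\mathsf D^k-\Lambda_{k,+}^{-1}\mathsf V_+^k\big).$$ Filtrations: $\mathcal F^k:=\sigma(\mathsf V^0,\mathsf V^0_+,\dots,\mathsf V^{k-1},\mathsf V_+^{k-1},\mathsf V^k)$ and $\mathcal F^k_+:=\sigma(\mathcal F^k\cup\sigma(\mathsf V_+^k))$, with $\mathcal F_+^{-1}$ the trivial $\sigma$-algebra. *)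

theory Defs
  imports "HOL-Analysis.Analysis" "HOL-Probability.Probability"
begin

definition eff_dom :: "('a \<Rightarrow> ereal) \<Rightarrow> 'a set" where
  "eff_dom \<phi> = {x. \<phi> x < \<infinity>}"

definition proper_fun :: "('a \<Rightarrow> ereal) \<Rightarrow> bool" where
  "proper_fun \<phi> \<longleftrightarrow> (\<forall>x. \<phi> x \<noteq> -\<infinity>) \<and> eff_dom \<phi> \<noteq> {}"

(* For functions that avoid -\<infinity> the right-hand side is unproblematic; the convention
   0 * \<infinity> = 0 of ereal makes the endpoints t = 0, 1 trivial. *)
definition convex_fun :: "('a::real_vector \<Rightarrow> ereal) \<Rightarrow> bool" where
  "convex_fun \<phi> \<longleftrightarrow>
     (\<forall>x y t. 0 \<le> t \<and> t \<le> 1 \<longrightarrow>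
        \<phi> ((1 - t) *\<^sub>R x + t *\<^sub>R y) \<le> ereal (1 - t) * \<phi> x + ereal t * \<phi> y)"

definition lsc_fun :: "('a::topological_space \<Rightarrow> ereal) \<Rightarrow> bool" where
  "lsc_fun \<phi> \<longleftrightarrow> (\<forall>x. \<phi> x \<le> Liminf (at x) \<phi>)"

definition weighted_norm :: "real^'n^'n \<Rightarrow> real^'n \<Rightarrow> real" where
  "weighted_norm \<Lambda> x = sqrt (x \<bullet> (\<Lambda> *v x))"

(* The minimiser exists and is unique when \<Lambda> is symmetric positive definite and \<phi> is convex,
   lower semicontinuous and proper; otherwise the value is an arbitrary choice. *)
definition prox :: "(real^'n \<Rightarrow> ereal) \<Rightarrow> real^'n^'n \<Rightarrow> real^'n \<Rightarrow> real^'n" where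
  "prox \<phi> \<Lambda> x = arg_min (\<lambda>y. \<phi> y + ereal (1/2 * (weighted_norm \<Lambda> (x - y))\<^sup>2)) (\<lambda>_. True)"

definition prox_residual ::
    "(real^'n \<Rightarrow> ereal) \<Rightarrow> real^'n^'n \<Rightarrow> real^'n \<Rightarrow> real^'n \<Rightarrow> real^'n" where
  "prox_residual \<phi> \<Lambda> v x = x - prox \<phi> \<Lambda> (x - matrix_inv \<Lambda> *v v)"

(* filt is F^k, filt_plus is F_+^k, and filt_prev is F_+^(k-1), trivial for k = 0.
   These measures matter only through their sigma-algebras. *)
definition filt ::
    "'w measure \<Rightarrow> (nat \<Rightarrow> 'w \<Rightarrow> real^'n) \<Rightarrow> (nat \<Rightarrow> 'w \<Rightarrow> real^'n) \<Rightarrow> nat \<Rightarrow> 'w measure" where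
  "filt M V Vp k = sigma (space M)
     ((\<Union>i\<in>{..k}. sets (vimage_algebra (space M) (V i) borel)) \<union>
      (\<Union>i\<in>{..<k}. sets (vimage_algebra (space M) (Vp i) borel)))"

definition filt_plus ::
    "'w measure \<Rightarrow> (nat \<Rightarrow> 'w \<Rightarrow> real^'n) \<Rightarrow> (nat \<Rightarrow> 'w \<Rightarrow> real^'n) \<Rightarrow> nat \<Rightarrow> 'w measure" where
  "filt_plus M V Vp k = sigma (space M)
     (sets (filt M V Vp k) \<union> sets (vimage_algebra (space M) (Vp k) borel))"

definition filt_prev ::
    "'w measure \<Rightarrow> (nat \<Rightarrow> 'w \<Rightarrow> real^'n) \<Rightarrow> (nat \<Rightarrow> 'w \<Rightarrow> real^'n) \<Rightarrow> nat \<Rightarrow> 'w measure" where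
  "filt_prev M V Vp k = (case k of 0 \<Rightarrow> sigma (space M) {} | Suc j \<Rightarrow> filt_plus M V Vp j)"

definition vec_cond_exp ::
    "'w measure \<Rightarrow> 'w measure \<Rightarrow> ('w \<Rightarrow> real^'n) \<Rightarrow> 'w \<Rightarrow> real^'n" where
  "vec_cond_exp M F Y \<omega> = (\<chi> i. real_cond_exp M F (\<lambda>\<omega>'. Y \<omega>' $ i) \<omega>)"

(* E[|Y|^2 | F], taken in [0,\<infinity>] so that no integrability is presupposed. *)
definition cond_sq ::
    "'w measure \<Rightarrow> 'w measure \<Rightarrow> ('w \<Rightarrow> real^'n) \<Rightarrow> 'w \<Rightarrow> ennreal" where
  "cond_sq M F Y = nn_cond_exp M F (\<lambda>\<omega>. ennreal ((norm (Y \<omega>))\<^sup>2))"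

end

theory Submission
  imports Defs
begin

text \<open>
  Let \<open>a = X\<^sup>k\<^sup>+\<^sup>1 - X\<^sup>k\<close> and let \<open>b\<close> be the stochastic proximal gradient step with parameter
  \<open>\<lambda>\<^sub>k\<close>. The variational inequalities of the two prox points and the descent lemma bound the
  increase of \<open>\<psi>\<close> pathwise by noise terms minus multiples of \<open>|a|\<^sup>2 / \<lambda>\<^sub>k\<^sub>+\<close> and \<open>|b|\<^sup>2 / \<lambda>\<^sub>k\<close>. Since prox maps
  are nonexpansive and the noise is centred, in expectation the noise costs at most
  \<open>\<lambda>\<^sub>k \<sigma>\<^sub>k\<^sup>2\<close> and \<open>\<lambda>\<^sub>k\<^sub>+ \<sigma>\<^sub>k\<^sub>+\<^sup>2\<close> (up to a factor), so that \<open>\<lambda>\<^sub>k |F(X\<^sup>k)|\<^sup>2\<close> and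
  \<open>|X\<^sup>k\<^sup>+\<^sup>1 - X\<^sup>k|\<^sup>2 / \<lambda>\<^sub>k\<close> have summable expectations; in particular no supermartingale convergence
  theorem is needed. As \<open>F\<close> is Lipschitz, the increments of \<open>|F(X\<^sup>k)|\<^sup>2\<close> are dominated by the
  sum of these two quantities. Hence \<open>|F(X\<^sup>k)|\<^sup>2\<close> converges, almost surely and in mean, and the
  limit is 0 because \<open>\<lambda>\<^sub>k\<close> is not summable. Summing the pathwise bounds before integrating avoids any
  measurability question for \<open>\<phi>\<close>.
\<close>

section \<open>Scaled identity matrices and the real-valued form of \<phi>\<close>

lemma norm_diff_scaleR_sq:
  fixes u v :: "'a::real_inner"
  shows "(norm (u - t *\<^sub>R v))\<^sup>2 = (norm u)\<^sup>2 - 2 * t * (u \<bullet> v) + t\<^sup>2 * (norm v)\<^sup>2"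
  unfolding power2_norm_eq_inner
  by (simp add: inner_diff inner_commute power2_eq_square[of t] algebra_simps)

lemma matrix_inv_scaled_mult:
  fixes v :: "real^'n"
  assumes "l \<noteq> 0"
  shows "matrix_inv (inverse l *\<^sub>R mat 1) *v v = l *\<^sub>R v"
proof -
  let ?A = "inverse l *\<^sub>R mat 1 :: real^'n^'n"
  have eq: "?A ** (l *\<^sub>R mat 1) = mat 1" "(l *\<^sub>R mat 1) ** ?A = mat 1"
    using assms by (simp_all add: scalar_matrix_assoc[symmetric] matrix_scalar_ac)
  then have "invertible ?A" by (auto simp: invertible_def)
  then have "?A ** matrix_inv ?A = mat 1"
    unfolding invertible_def matrix_inv_def by (metis (mono_tags, lifting) someI_ex)
  then have "v = ?A *v (matrix_inv ?A *v v)"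
    by (simp add: matrix_vector_mul_assoc)
  also have "\<dots> = inverse l *\<^sub>R (matrix_inv ?A *v v)"
    by (simp add: scaleR_matrix_vector_assoc[symmetric])
  finally have "l *\<^sub>R v = l *\<^sub>R inverse l *\<^sub>R (matrix_inv ?A *v v)" by simp
  then show ?thesis using assms by simp
qed

locale convex_lsc_proper =
  fixes \<phi> :: "real^'n \<Rightarrow> ereal"
  assumes convex: "convex_fun \<phi>" and lsc: "lsc_fun \<phi>" and proper: "proper_fun \<phi>"
begin

text \<open>On \<open>eff_dom \<phi>\<close> this is \<phi> itself. Elsewhere \<phi> is \<infinity>
  and \<open>real_of_ereal\<close> returns the default 0, so \<open>h\<close> is meaningful only
  together with a domain hypothesis.\<close>

definition h :: "real^'n \<Rightarrow> real" where
  "h y = real_of_ereal (\<phi> y)"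

text \<open>The index is the step size, that is, the inverse of the weight: the quadratic term
  becomes the squared distance divided by \<open>2 * l\<close>.\<close>

abbreviation P :: "real \<Rightarrow> real^'n \<Rightarrow> real^'n" where
  "P l \<equiv> prox \<phi> (inverse l *\<^sub>R mat 1)"

lemma phi_not_MInf: "\<phi> y \<noteq> -\<infinity>"
  using proper by (simp add: proper_fun_def)

lemma phi_eq_h: "y \<in> eff_dom \<phi> \<Longrightarrow> \<phi> y = ereal (h y)"
  using phi_not_MInf[of y] by (cases "\<phi> y") (auto simp: eff_dom_def h_def)

lemma ereal_in_dom: "\<phi> y \<le> ereal r \<Longrightarrow> y \<in> eff_dom \<phi>"
  by (auto simp: eff_dom_def intro: le_less_trans)

lemma convex_h:
  assumes "x \<in> eff_dom \<phi>" "y \<in> eff_dom \<phi>" "0 \<le> t" "t \<le> 1"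
  shows "(1 - t) *\<^sub>R x + t *\<^sub>R y \<in> eff_dom \<phi>"
    and "h ((1 - t) *\<^sub>R x + t *\<^sub>R y) \<le> (1 - t) * h x + t * h y"
proof -
  have "\<phi> ((1 - t) *\<^sub>R x + t *\<^sub>R y) \<le> ereal (1 - t) * \<phi> x + ereal t * \<phi> y"
    using convex assms(3,4) by (simp add: convex_fun_def)
  also have "\<dots> = ereal ((1 - t) * h x + t * h y)"
    using assms(1,2) by (subst (1 2) phi_eq_h) auto
  finally have *: "\<phi> ((1 - t) *\<^sub>R x + t *\<^sub>R y) \<le> ereal ((1 - t) * h x + t * h y)" .
  then show "(1 - t) *\<^sub>R x + t *\<^sub>R y \<in> eff_dom \<phi>"
    by (rule ereal_in_dom)
  then show "h ((1 - t) *\<^sub>R x + t *\<^sub>R y) \<le> (1 - t) * h x + t * h y"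
    using * by (metis ereal_less_eq(3) phi_eq_h)
qed

end

section \<open>Lower semicontinuity and attainment of minima\<close>

lemma lsc_fun_open_superlevel:
  assumes "lsc_fun g"
  shows "open {y. (c::ereal) < g y}"
proof (subst open_subopen, intro ballI)
  fix x assume "x \<in> {y. c < g y}"
  then have c: "c < g x" by simp
  have "g x \<le> Liminf (at x) g"
    using assms by (simp add: lsc_fun_def)
  then have "eventually (\<lambda>y. c < g y) (at x)"
    using c by (auto simp: le_Liminf_iff)
  then obtain S where "open S" "x \<in> S" "\<And>y. y \<in> S \<Longrightarrow> y \<noteq> x \<Longrightarrow> c < g y"
    by (auto simp: eventually_at_topological)
  \<comment> \<open>\<open>Liminf (at x)\<close> ignores \<open>x\<close> itself, which lies in the
    superlevel set by assumption.\<close>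
  then show "\<exists>T. open T \<and> x \<in> T \<and> T \<subseteq> {y. c < g y}"
    using c by (intro exI[of _ S]) auto
qed

text \<open>Weierstrass for lower semicontinuous functions. Without a minimum, the open sets
  \<open>{z. g y < g z}\<close> with \<open>y\<close> in \<open>K\<close> cover \<open>K\<close>; a
  finite subcover fails at the centre of least value.\<close>

lemma compact_attains_inf_superlevel:
  fixes g :: "'a::topological_space \<Rightarrow> 'b::linorder"
  assumes "compact K" "K \<noteq> {}" and op: "\<And>c. open {y. c < g y}"
  obtains x where "x \<in> K" "\<And>y. y \<in> K \<Longrightarrow> g x \<le> g y"
proof (rule ccontr)
  assume "\<not> thesis"
  then have *: "\<forall>x\<in>K. \<exists>y\<in>K. g y < g x"
    using that by (meson not_le)
  have cov: "K \<subseteq> (\<Union>y\<in>K. {z. g y < g z})"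
    using * by auto
  obtain C where C: "C \<subseteq> K" "finite C" "K \<subseteq> (\<Union>y\<in>C. {z. g y < g z})"
    by (rule compactE_image[OF assms(1) _ cov]) (use op in auto)
  then have "C \<noteq> {}" using assms(2) by auto
  then have "Min (g ` C) \<in> g ` C"
    using C by (intro Min_in) auto
  then obtain y where y: "y \<in> C" "g y = Min (g ` C)" by force
  then obtain z where "z \<in> C" "g z < g y"
    using C by blast
  then show False
    using y C(2) by (simp add: leD)
qed

section \<open>Existence of prox points and properties of the prox map\<close>

context convex_lsc_proper
begin

text \<open>This makes the prox objective coercive. The minimum over the unit ball around
  \<open>x\<close> bounds the drop of \<phi> there by \<open>B\<close>; convexity along segments
  from \<open>x\<close> then makes \<open>B\<close> a bound on the slope of descent further
  out.\<close>

lemma affine_lower_bound: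
  assumes x: "x \<in> eff_dom \<phi>"
  obtains A B where "0 \<le> B" "\<And>y. ereal (- A - B * dist x y) \<le> \<phi> y"
proof -
  obtain p where p: "\<And>y. y \<in> cball x 1 \<Longrightarrow> \<phi> p \<le> \<phi> y"
    by (rule compact_attains_inf_superlevel[of "cball x 1" \<phi>])
      (auto simp: lsc_fun_open_superlevel[OF lsc])
  have pd: "p \<in> eff_dom \<phi>"
    using p[of x] x by (auto simp: eff_dom_def intro: le_less_trans)
  have hp: "h p \<le> h y" if "y \<in> cball x 1" "y \<in> eff_dom \<phi>" for y
    using p[OF that(1)] that pd by (simp add: phi_eq_h)
  define B where "B = h x - h p"
  have B: "0 \<le> B" using hp[of x] x by (simp add: B_def)
  have "ereal (- (B - h x) - B * dist x y) \<le> \<phi> y" for y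
  proof (cases "y \<in> eff_dom \<phi>")
    case False
    then show ?thesis by (auto simp: eff_dom_def)
  next
    case True
    have "h x - B - B * dist x y \<le> h y"
    proof (cases "dist x y \<le> 1")
      case True
      then have "h p \<le> h y" using hp \<open>y \<in> eff_dom \<phi>\<close> by simp
      then show ?thesis
        using mult_nonneg_nonneg[OF B zero_le_dist[of x y]] by (simp add: B_def)
    next
      case False
      \<comment> \<open>This \<open>t\<close> puts \<open>z\<close> on the unit sphere around
        \<open>x\<close>, where \<open>h p\<close> is still a lower bound.\<close>
      define t where "t = 1 / dist x y"
      have t: "0 < t" "t \<le> 1" using False by (auto simp: t_def divide_le_eq)
      define z where "z = (1 - t) *\<^sub>R x + t *\<^sub>R y"
      have "z - x = t *\<^sub>R (y - x)" by (simp add: z_def algebra_simps)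
      then have "norm (z - x) = 1"
        using False t by (simp add: dist_norm norm_minus_commute[of y] t_def)
      then have "dist x z = 1"
        by (simp add: dist_norm norm_minus_commute)
      then have "h p \<le> h z"
        using convex_h(1)[OF x True, of t] t by (intro hp) (auto simp: z_def)
      also have "h z \<le> (1 - t) * h x + t * h y"
        using convex_h(2)[OF x True, of t] t by (auto simp: z_def)
      finally have "- B \<le> t * (h y - h x)" by (simp add: B_def algebra_simps)
      then have "- B * dist x y \<le> h y - h x"
        using False pos_le_divide_eq[of "dist x y" "- B" "h y - h x"] by (force simp: t_def)
      then show ?thesis using B by simp
    qed
    then show ?thesis using True by (simp add: phi_eq_h)
  qed
  then show thesis using that B by blast
qed

lemma weighted_norm_scaled: "0 < l \<Longrightarrow> (weighted_norm (inverse l *\<^sub>R mat 1) z)\<^sup>2 = (norm z)\<^sup>2 / l"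
  by (simp add: weighted_norm_def scaleR_matrix_vector_assoc[symmetric] power2_norm_eq_inner divide_inverse)

text \<open>\<open>prox\<close> is a mere choice until a minimiser is known to exist. The objective
  \<open>g\<close> is lower semicontinuous, and far from \<open>x\<close> the quadratic term beats
  the affine lower bound of \<phi>, so a minimum over a large ball is global.\<close>

lemma prox_minimizes:
  assumes l: "0 < l"
  shows "\<phi> (P l x) + ereal ((norm (x - P l x))\<^sup>2 / (2 * l)) \<le> \<phi> y + ereal ((norm (x - y))\<^sup>2 / (2 * l))"
proof -
  define g where "g y = \<phi> y + ereal ((norm (x - y))\<^sup>2 / (2 * l))" for y
  obtain w where w: "w \<in> eff_dom \<phi>" using proper by (auto simp: proper_fun_def)
  obtain A B where AB: "0 \<le> B" "\<And>y. ereal (- A - B * dist w y) \<le> \<phi> y"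
    using affine_lower_bound[OF w] by blast
  define C where "C = h w + (norm (x - w))\<^sup>2 / (2 * l)"
  have gw: "g w = ereal C" using w by (simp add: g_def C_def phi_eq_h)
  have op: "open {y. c < g y}" for c
  proof -
    \<comment> \<open>Splitting the sum at a real \<open>r\<close> reduces the claim to superlevel
      sets of \<phi> and of a continuous function.\<close>
    have "{y. c < g y} = (\<Union>r::real. {y. ereal r < \<phi> y} \<inter> {y. c < ereal (r + (norm (x - y))\<^sup>2 / (2 * l))})"
      (is "_ = ?U")
    proof (intro set_eqI iffI)
      fix y assume "y \<in> {y. c < g y}"
      then obtain s where s: "c < ereal s" "ereal s < g y"
        using ereal_dense2[of c "g y"] by auto
      define r where "r = s - (norm (x - y))\<^sup>2 / (2 * l)"
      have "ereal r < \<phi> y"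
        using s(2) phi_not_MInf[of y] by (cases "\<phi> y") (auto simp: g_def r_def)
      then show "y \<in> ?U" using s(1) by (auto simp: r_def intro!: exI[of _ r])
    next
      fix y assume "y \<in> ?U"
      then obtain r where r: "ereal r < \<phi> y" "c < ereal (r + (norm (x - y))\<^sup>2 / (2 * l))" by auto
      have "ereal (r + (norm (x - y))\<^sup>2 / (2 * l)) \<le> g y"
        using r(1) by (cases "\<phi> y") (auto simp: g_def)
      then show "y \<in> {y. c < g y}" using r(2) by simp
    qed
    moreover have "open \<dots>"
      by (intro open_UN ballI open_Int lsc_fun_open_superlevel[OF lsc] open_Collect_less continuous_intros)
        (use l in auto)
    ultimately show ?thesis by simp
  qed
  \<comment> \<open>\<open>E\<close> exceeds \<open>C + A + B * dist w x\<close>; beyond radius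
    \<open>R\<close> the quadratic term outweighs \<open>B\<close> times the distance from
    \<open>x\<close> by at least \<open>E\<close>.\<close>
  define E where "E = \<bar>C + A + B * dist w x\<bar> + 1"
  define R where "R = 2 * l * (B + E) + 1"
  have out: "g w < g y" if "R < dist x y" for y
  proof -
    let ?n = "dist x y"
    have E: "0 \<le> E" by (simp add: E_def)
    have "2 * l * (B + E) + 1 \<le> ?n" using that by (simp add: R_def)
    moreover have "0 \<le> 2 * l * (B + E)" using l AB(1) E by (intro mult_nonneg_nonneg) auto
    ultimately have "1 \<le> ?n" "2 * l * (B + E) \<le> ?n"
      by linarith+
    then have n: "1 \<le> ?n" "B + E \<le> ?n / (2 * l)"
      using l by (auto simp: pos_le_divide_eq mult.commute)
    have "1 * E \<le> ?n * (?n / (2 * l) - B)"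
      using n by (intro mult_mono) (auto simp: E_def)
    then have "E \<le> ?n\<^sup>2 / (2 * l) - B * ?n"
      by (simp add: algebra_simps power2_eq_square)
    moreover have "B * dist w y \<le> B * dist w x + B * ?n"
      using mult_left_mono[OF dist_triangle[of w y x] AB(1)] by (simp add: algebra_simps dist_commute)
    ultimately have "C < - A - B * dist w y + ?n\<^sup>2 / (2 * l)"
      by (auto simp: E_def)
    then have "g w < ereal (- A - B * dist w y) + ereal (?n\<^sup>2 / (2 * l))"
      by (simp add: gw)
    also have "\<dots> \<le> g y"
      unfolding g_def dist_norm[of x y, symmetric] by (intro add_right_mono AB(2))
    finally show ?thesis .
  qed
  have R: "0 \<le> R" using l AB(1) by (auto simp: R_def E_def)
  \<comment> \<open>The radius is enlarged so that the ball contains \<open>w\<close>, through which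
    points outside radius \<open>R\<close> are compared with \<open>p\<close>.\<close>
  obtain p where p: "\<And>y. y \<in> cball x (max R (dist x w)) \<Longrightarrow> g p \<le> g y"
    by (rule compact_attains_inf_superlevel[of "cball x (max R (dist x w))" g]) (use op R in auto)
  have "g p \<le> g y" for y
    using p[of y] p[of w] out[of y] by (cases "R < dist x y") auto
  then have "is_arg_min g (\<lambda>_. True) p"
    by (auto simp: is_arg_min_def not_less)
  moreover have "P l x = arg_min g (\<lambda>_. True)"
    by (simp add: prox_def g_def[abs_def] weighted_norm_scaled[OF l])
  ultimately have "is_arg_min g (\<lambda>_. True) (P l x)"
    unfolding arg_min_def by (metis someI)
  then show ?thesis by (auto simp: is_arg_min_def not_less g_def)
qed

lemma prox_in_dom: "0 < l \<Longrightarrow> P l x \<in> eff_dom \<phi>"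
proof -
  assume l: "0 < l"
  obtain w where w: "w \<in> eff_dom \<phi>" using proper by (auto simp: proper_fun_def)
  have "\<phi> (P l x) + ereal ((norm (x - P l x))\<^sup>2 / (2 * l)) < \<infinity>"
    using prox_minimizes[OF l, of x w] w by (auto simp: phi_eq_h intro: le_less_trans)
  then show ?thesis by (auto simp: eff_dom_def)
qed

text \<open>First-order optimality without subdifferentials: the prox point is compared with the
  point at parameter \<open>t\<close> on the segment to \<open>y\<close>, the inequality is divided
  by \<open>t\<close>, and \<open>t\<close> tends to 0.\<close>

lemma prox_variational:
  assumes l: "0 < l" and y: "y \<in> eff_dom \<phi>"
  shows "h (P l x) + (x - P l x) \<bullet> (y - P l x) / l \<le> h y"
proof -
  define p where "p = P l x"
  have pd: "p \<in> eff_dom \<phi>" using prox_in_dom[OF l] by (simp add: p_def)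
  have "h p + (x - p) \<bullet> (y - p) / l - h y \<le> t * ((norm (y - p))\<^sup>2 / (2 * l))" if t: "0 < t" "t < 1" for t
  proof -
    define z where "z = (1 - t) *\<^sub>R p + t *\<^sub>R y"
    have zd: "z \<in> eff_dom \<phi>" and hz: "h z \<le> (1 - t) * h p + t * h y"
      using convex_h[OF pd y, of t] t by (auto simp: z_def)
    have "h p + (norm (x - p))\<^sup>2 / (2 * l) \<le> h z + (norm (x - z))\<^sup>2 / (2 * l)"
      using prox_minimizes[OF l, of x z] pd zd by (simp add: p_def[symmetric] phi_eq_h)
    also have "x - z = (x - p) - t *\<^sub>R (y - p)" by (simp add: z_def algebra_simps)
    also have "(norm ((x - p) - t *\<^sub>R (y - p)))\<^sup>2
        = (norm (x - p))\<^sup>2 - 2 * t * ((x - p) \<bullet> (y - p)) + t\<^sup>2 * (norm (y - p))\<^sup>2"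
      by (rule norm_diff_scaleR_sq)
    finally have "h p + (norm (x - p))\<^sup>2 / (2 * l)
        \<le> h z + ((norm (x - p))\<^sup>2 / (2 * l) - t * ((x - p) \<bullet> (y - p) / l) + t * (t * ((norm (y - p))\<^sup>2 / (2 * l))))"
      using l by (simp add: add_divide_distrib diff_divide_distrib power2_eq_square mult.assoc)
    then have "t * (h p + (x - p) \<bullet> (y - p) / l - h y) \<le> t * (t * ((norm (y - p))\<^sup>2 / (2 * l)))"
      using hz unfolding ring_distribs by linarith
    then show ?thesis using t by (simp only: mult_le_cancel_left_pos)
  qed
  then have "eventually (\<lambda>t. h p + (x - p) \<bullet> (y - p) / l - h y \<le> t * ((norm (y - p))\<^sup>2 / (2 * l))) (at_right 0)"
    by (intro eventually_at_rightI[of 0 1]) auto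
  moreover have "((\<lambda>t. t * ((norm (y - p))\<^sup>2 / (2 * l))) \<longlongrightarrow> 0 * ((norm (y - p))\<^sup>2 / (2 * l))) (at_right 0)"
    by (intro tendsto_intros)
  ultimately have "h p + (x - p) \<bullet> (y - p) / l - h y \<le> 0 * ((norm (y - p))\<^sup>2 / (2 * l))"
    by (intro tendsto_lowerbound) auto
  then show ?thesis by (simp add: p_def)
qed

text \<open>Testing each prox point against the other and adding cancels \<open>h\<close> and yields
  firm nonexpansiveness; Cauchy-Schwarz does the rest.\<close>

lemma prox_nonexpansive:
  assumes l: "0 < l"
  shows "norm (P l x - P l y) \<le> norm (x - y)"
proof -
  define p q where "p = P l x" and "q = P l y"
  have "((x - p) \<bullet> (q - p) + (y - q) \<bullet> (p - q)) / l \<le> 0"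
    using prox_variational[OF l prox_in_dom[OF l], of x y] prox_variational[OF l prox_in_dom[OF l], of y x]
    by (simp add: p_def q_def add_divide_distrib)
  then have "(x - p) \<bullet> (q - p) + (y - q) \<bullet> (p - q) \<le> 0"
    using l by (simp add: divide_le_0_iff)
  then have "(norm (p - q))\<^sup>2 \<le> (x - y) \<bullet> (p - q)"
    by (simp add: power2_norm_eq_inner inner_diff inner_commute)
  also have "\<dots> \<le> norm (x - y) * norm (p - q)"
    by (rule norm_cauchy_schwarz)
  finally show ?thesis
    by (cases "p = q") (auto simp: power2_eq_square p_def[symmetric] q_def[symmetric])
qed

lemma prox_residual_scaled:
  "0 < l \<Longrightarrow> prox_residual \<phi> (inverse l *\<^sub>R mat 1) v x = x - P l (x - l *\<^sub>R v)"
  by (simp add: prox_residual_def matrix_inv_scaled_mult)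

text \<open>Relates a residual with a small step size to the one with step size 1. The variational
  inequalities of both prox points and Cauchy-Schwarz give
  \<open>(s - r) * (s - l * r) \<le> 0\<close>, so \<open>s\<close> lies between
  \<open>l * r\<close> and \<open>r\<close>.\<close>

lemma residual_monotone:
  assumes l: "0 < l" "l \<le> 1"
  shows "l * norm (x - P 1 (x - g)) \<le> norm (x - P l (x - l *\<^sub>R g))"
proof -
  define p q where "p = P l (x - l *\<^sub>R g)" and "q = P 1 (x - g)"
  define s r where "s = norm (x - p)" and "r = norm (x - q)"
  have "((x - l *\<^sub>R g - p) \<bullet> (q - p)) / l + (x - g - q) \<bullet> (p - q) \<le> 0"
    using prox_variational[OF l(1) prox_in_dom[of 1], of "x - l *\<^sub>R g" "x - g"]
      prox_variational[OF zero_less_one prox_in_dom[OF l(1)], of "x - g" "x - l *\<^sub>R g"]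
    by (simp add: p_def q_def)
  then have "((x - l *\<^sub>R g - p) \<bullet> (q - p)) + l * ((x - g - q) \<bullet> (p - q)) \<le> 0"
    using l by (simp add: field_simps)
  then have "s\<^sup>2 + l * r\<^sup>2 \<le> (1 + l) * ((x - p) \<bullet> (x - q))"
    by (simp add: s_def r_def power2_norm_eq_inner inner_diff inner_commute algebra_simps)
  also have "\<dots> \<le> (1 + l) * (s * r)"
    using l norm_cauchy_schwarz[of "x - p" "x - q"] by (intro mult_left_mono) (auto simp: s_def r_def)
  finally have *: "(s - r) * (s - l * r) \<le> 0"
    by (simp add: algebra_simps power2_eq_square)
  have "l * r \<le> s"
  proof (rule ccontr)
    assume "\<not> l * r \<le> s"
    moreover have "l * r \<le> 1 * r" using l by (intro mult_right_mono) (auto simp: r_def)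
    ultimately have "0 < (s - r) * (s - l * r)" by (intro mult_neg_neg) auto
    with * show False by simp
  qed
  then show ?thesis by (simp add: s_def r_def p_def q_def)
qed

end

section \<open>The descent lemma and a convergence criterion for real sequences\<close>

lemma descent_lemma:
  fixes f :: "'a::euclidean_space \<Rightarrow> real"
  assumes grad: "\<And>x. GDERIV f x :> g x" and lip: "L-lipschitz_on UNIV g"
  shows "f y \<le> f x + g x \<bullet> (y - x) + L / 2 * (norm (y - x))\<^sup>2"
proof -
  define d where "d = y - x"
  \<comment> \<open>The claim is \<open>q 1 \<le> q 0\<close>, so it suffices that the derivative of
    \<open>q\<close> is nonpositive on the unit interval.\<close>
  define q where "q t = f (x + t *\<^sub>R d) - t * (g x \<bullet> d) - L / 2 * t\<^sup>2 * (norm d)\<^sup>2" for t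
  have "(q has_real_derivative g (x + t *\<^sub>R d) \<bullet> d - g x \<bullet> d - L * t * (norm d)\<^sup>2) (at t)" for t
  proof -
    have "(f has_derivative (\<lambda>h. h \<bullet> g (x + t *\<^sub>R d))) (at (x + t *\<^sub>R d))"
      using grad by (simp add: gderiv_def)
    then have "((\<lambda>t. f (x + t *\<^sub>R d)) has_derivative (\<lambda>h. (h *\<^sub>R d) \<bullet> g (x + t *\<^sub>R d))) (at t)"
      by (rule has_derivative_compose[rotated]) (auto intro!: derivative_eq_intros)
    then have "((\<lambda>t. f (x + t *\<^sub>R d)) has_real_derivative g (x + t *\<^sub>R d) \<bullet> d) (at t)"
      by (simp add: has_field_derivative_def inner_commute mult.commute[of _ "d \<bullet> _"])
    then show ?thesis
      unfolding q_def by (auto intro!: derivative_eq_intros)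
  qed
  moreover have "g (x + t *\<^sub>R d) \<bullet> d - g x \<bullet> d - L * t * (norm d)\<^sup>2 \<le> 0" if "0 \<le> t" for t
  proof -
    have "norm (g (x + t *\<^sub>R d) - g x) \<le> L * (t * norm d)"
      using lipschitz_onD[OF lip, of "x + t *\<^sub>R d" x] that by (simp add: dist_norm)
    then have "(g (x + t *\<^sub>R d) - g x) \<bullet> d \<le> L * (t * norm d) * norm d"
      by (meson norm_cauchy_schwarz order_trans mult_right_mono norm_ge_zero)
    then show ?thesis by (simp add: inner_diff power2_eq_square algebra_simps)
  qed
  ultimately have "q 1 \<le> q 0"
    by (intro DERIV_nonpos_imp_nonincreasing[of 0 1 q]) (simp, blast)
  then show ?thesis by (simp add: q_def d_def)
qed

text \<open>Summable increments make \<open>u\<close> converge; a positive limit would make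
  \<open>l\<close> summable by comparison with \<open>l k * u k\<close>. It serves both for single
  paths and for second moments.\<close>

lemma summable_weighted_imp_tendsto_zero:
  fixes u l :: "nat \<Rightarrow> real"
  assumes u: "\<And>k. 0 \<le> u k" and l: "\<And>k. 0 \<le> l k"
    and lu: "summable (\<lambda>k. l k * u k)" and du: "summable (\<lambda>k. \<bar>u (Suc k) - u k\<bar>)"
    and div: "filterlim (\<lambda>n. \<Sum>k<n. l k) at_top sequentially"
  shows "u \<longlonglongrightarrow> 0"
proof -
  have "summable (\<lambda>k. u (Suc k) - u k)"
    using du by (rule summable_rabs_cancel)
  then have "(\<lambda>n. \<Sum>k<n. u (Suc k) - u k) \<longlonglongrightarrow> (\<Sum>k. u (Suc k) - u k)"
    by (rule summable_LIMSEQ)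
  then have "(\<lambda>n. (\<Sum>k<n. u (Suc k) - u k) + u 0) \<longlonglongrightarrow> (\<Sum>k. u (Suc k) - u k) + u 0"
    by (intro tendsto_intros)
  then obtain c where c: "u \<longlonglongrightarrow> c"
    by (auto simp: sum_lessThan_telescope)
  have "0 \<le> c" using c u by (intro LIMSEQ_le_const[OF c]) auto
  moreover have "\<not> 0 < c"
  proof
    assume "0 < c"
    then have "eventually (\<lambda>k. c / 2 < u k) sequentially"
      by (intro order_tendstoD[OF c]) simp
    then have "eventually (\<lambda>k. norm (l k) \<le> 2 / c * (l k * u k)) sequentially"
    proof eventually_elim
      case (elim k)
      have "l k * (c / 2) \<le> l k * u k" using elim l by (intro mult_left_mono) auto
      then show ?case using \<open>0 < c\<close> l[of k] by (simp add: field_simps)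
    qed
    then have "summable l"
      by (rule summable_comparison_test_ev) (intro summable_mult lu)
    then have "(\<lambda>n. \<Sum>k<n. l k) \<longlonglongrightarrow> suminf l"
      by (rule summable_LIMSEQ)
    with div show False
      using not_tendsto_and_filterlim_at_infinity[OF sequentially_bot]
        filterlim_at_top_imp_at_infinity by blast
  qed
  ultimately show ?thesis using c by simp
qed

section \<open>Pathwise energy estimates for one step\<close>

context convex_lsc_proper
begin

text \<open>The comparison passes through \<open>x + b\<close> because \<open>norm b\<close>
  controls the residual at \<open>x\<close> up to noise and, through the growth condition on the
  directions, also \<open>d\<close> in mean square.\<close>

lemma energy_step:
  fixes f :: "real^'n \<Rightarrow> real" and g :: "real^'n \<Rightarrow> real^'n"
  assumes grad: "\<And>x. GDERIV f x :> g x" and lip: "L-lipschitz_on UNIV g"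
    and l: "0 < l" and l': "0 < l'" and x: "x \<in> eff_dom \<phi>"
    and a_def: "a = P l' (x + al *\<^sub>R d - l' *\<^sub>R v') - x" and b_def: "b = P l (x - l *\<^sub>R v) - x"
  shows "(f (x + a) + h (x + a)) - (f x + h x)
    \<le> (g x - v') \<bullet> (a - b) + (g x - v) \<bullet> b + al / l' * (d \<bullet> (a - b))
      + (L / 2 - 1 / (2 * l')) * (norm a)\<^sup>2 + (1 / (2 * l') - 1 / l) * (norm b)\<^sup>2
      - 1 / (2 * l') * (norm (a - b))\<^sup>2"
proof -
  \<comment> \<open>The prox point \<open>x + b\<close> is tested against \<open>x\<close>, and \<open>x + a\<close> against \<open>x + b\<close>.\<close>
  have "h (x + b) + (- l *\<^sub>R v - b) \<bullet> (- b) / l \<le> h x"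
    using prox_variational[OF l x, of "x - l *\<^sub>R v"] by (simp add: b_def algebra_simps)
  moreover have "(- l *\<^sub>R v - b) \<bullet> (- b) / l = v \<bullet> b + (norm b)\<^sup>2 / l"
    using l by (simp add: power2_norm_eq_inner inner_diff add_divide_distrib)
  ultimately have 1: "h (x + b) + v \<bullet> b + (norm b)\<^sup>2 / l \<le> h x" by simp
  have "x + b \<in> eff_dom \<phi>"
    using prox_in_dom[OF l] by (simp add: b_def)
  then have "h (x + a) + (al *\<^sub>R d - l' *\<^sub>R v' - a) \<bullet> (b - a) / l' \<le> h (x + b)"
    using prox_variational[OF l', of "x + b" "x + al *\<^sub>R d - l' *\<^sub>R v'"] by (simp add: a_def algebra_simps)
  \<comment> \<open>Polarisation of \<open>a \<bullet> (a - b)\<close>. It supplies the negative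
    multiple of \<open>(norm (a - b))\<^sup>2\<close> that later absorbs the terms in
    \<open>d\<close>.\<close>
  moreover have "(al *\<^sub>R d - l' *\<^sub>R v' - a) \<bullet> (b - a) / l'
      = - (al / l' * (d \<bullet> (a - b))) + v' \<bullet> (a - b)
        + (1 / (2 * l')) * (norm a)\<^sup>2 - (1 / (2 * l')) * (norm b)\<^sup>2 + (1 / (2 * l')) * (norm (a - b))\<^sup>2"
    using l' unfolding power2_norm_eq_inner by (simp add: inner_diff inner_add inner_commute field_simps)
  moreover have "f (x + a) \<le> f x + g x \<bullet> a + L / 2 * (norm a)\<^sup>2"
    using descent_lemma[OF grad lip, of "x + a" x] by simp
  ultimately show ?thesis
    using 1 by (simp add: inner_diff algebra_simps)
qed

text \<open>Replacing the noisy prox point by its noise-free counterpart, which is measurable with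
  respect to the past, leaves a term that is orthogonal in expectation to the noise.\<close>

lemma inner_prox_noise:
  assumes l: "0 < l"
  shows "(y - v) \<bullet> (P l (u - l *\<^sub>R v) - x) \<le> l * (norm (y - v))\<^sup>2 + (y - v) \<bullet> (P l (u - l *\<^sub>R y) - x)"
proof -
  have "(y - v) \<bullet> (P l (u - l *\<^sub>R v) - P l (u - l *\<^sub>R y)) \<le> norm (y - v) * norm (P l (u - l *\<^sub>R v) - P l (u - l *\<^sub>R y))"
    by (rule norm_cauchy_schwarz)
  also have "\<dots> \<le> norm (y - v) * (l * norm (y - v))"
  proof (intro mult_left_mono norm_ge_zero)
    have "norm (P l (u - l *\<^sub>R v) - P l (u - l *\<^sub>R y)) \<le> norm (l *\<^sub>R (y - v))"
      using prox_nonexpansive[OF l, of "u - l *\<^sub>R v" "u - l *\<^sub>R y"] by (simp add: algebra_simps)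
    then show "norm (P l (u - l *\<^sub>R v) - P l (u - l *\<^sub>R y)) \<le> l * norm (y - v)"
      using l by simp
  qed
  finally show ?thesis by (simp add: inner_diff power2_eq_square algebra_simps)
qed

text \<open>Each error is paired with a vector that will be fixed before the corresponding sample is
  drawn, so that the pairing vanishes in expectation; otherwise the errors enter only
  quadratically.\<close>

lemma energy_step_noise:
  fixes f :: "real^'n \<Rightarrow> real" and g :: "real^'n \<Rightarrow> real^'n"
  assumes grad: "\<And>x. GDERIV f x :> g x" and lip: "L-lipschitz_on UNIV g"
    and l: "0 < l" and l': "0 < l'" "L * l' \<le> 1 - r" and nonneg: "0 \<le> al" "0 \<le> be"
    and x: "x \<in> eff_dom \<phi>"
    and x'_def: "x' = P l' (x + al *\<^sub>R d - l' *\<^sub>R v')" and z_def: "z = x + be *\<^sub>R d"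
    and b_def: "b = P l (x - l *\<^sub>R v) - x"
  shows "(f x' + h x') - (f x + h x)
    \<le> l' * (norm (g z - v'))\<^sup>2 + l * (norm (g x - v))\<^sup>2
      + (g z - v') \<bullet> (P l' (x + al *\<^sub>R d - l' *\<^sub>R g z) - x - b) + (g x - v) \<bullet> (P l (x - l *\<^sub>R g x) - x)
      + (al + L * be * l')\<^sup>2 / (2 * l') * (norm d)\<^sup>2
      - r / (2 * l') * (norm (x' - x))\<^sup>2 + (1 / (2 * l') - 1 / l) * (norm b)\<^sup>2"
proof -
  define a where "a = x' - x"
  have "norm (g x - g z) \<le> L * be * norm d"
    using lipschitz_onD[OF lip, of x z] nonneg by (simp add: z_def dist_norm)
  then have "(g x - g z) \<bullet> (a - b) \<le> L * be * norm d * norm (a - b)"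
    by (meson norm_cauchy_schwarz order_trans mult_right_mono norm_ge_zero)
  moreover have "al / l' * (d \<bullet> (a - b)) \<le> al / l' * (norm d * norm (a - b))"
    using nonneg l' by (intro mult_left_mono norm_cauchy_schwarz) auto
  \<comment> \<open>The shift from \<open>g x\<close> to \<open>g z\<close> and the term with
    \<open>al\<close> add up to \<open>S / l'\<close> times \<open>norm d * norm (a - b)\<close>.
    Young's inequality uses up exactly the available multiple of
    \<open>(norm (a - b))\<^sup>2\<close>.\<close>
  moreover have "L * be * norm d * norm (a - b) + al / l' * (norm d * norm (a - b))
      \<le> (al + L * be * l')\<^sup>2 / (2 * l') * (norm d)\<^sup>2 + 1 / (2 * l') * (norm (a - b))\<^sup>2"
  proof -
    define S where "S = al + L * be * l'"
    have "2 * (S * norm d) * norm (a - b) \<le> (S * norm d)\<^sup>2 + (norm (a - b))\<^sup>2"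
      by (rule sum_squares_bound)
    then have "2 * (S * norm d) * norm (a - b) / (2 * l') \<le> ((S * norm d)\<^sup>2 + (norm (a - b))\<^sup>2) / (2 * l')"
      using l' by (intro divide_right_mono) auto
    moreover have "L * be * norm d * norm (a - b) + al / l' * (norm d * norm (a - b)) = 2 * (S * norm d) * norm (a - b) / (2 * l')"
      using l' by (simp add: S_def field_simps)
    ultimately show ?thesis
      by (simp add: S_def power_mult_distrib add_divide_distrib)
  qed
  \<comment> \<open>The bound on \<open>L * l'\<close> keeps a fraction \<open>r\<close> of the
    negative quadratic term in \<open>a\<close>.\<close>
  moreover have "(L / 2 - 1 / (2 * l')) * (norm a)\<^sup>2 \<le> (- (r / (2 * l'))) * (norm a)\<^sup>2"
  proof (rule mult_right_mono)
    have "L \<le> (1 - r) / l'" using l' by (simp add: pos_le_divide_eq)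
    also have "\<dots> = 2 * (1 / (2 * l')) - 2 * (r / (2 * l'))" by (simp add: diff_divide_distrib)
    finally show "L / 2 - 1 / (2 * l') \<le> - (r / (2 * l'))" by simp
  qed simp
  moreover have "(g z - v') \<bullet> a \<le> l' * (norm (g z - v'))\<^sup>2 + (g z - v') \<bullet> (P l' (x + al *\<^sub>R d - l' *\<^sub>R g z) - x)"
    using inner_prox_noise[OF l'(1), of "g z" v' "x + al *\<^sub>R d" x] by (simp add: a_def x'_def)
  moreover have "(g x - v) \<bullet> b \<le> l * (norm (g x - v))\<^sup>2 + (g x - v) \<bullet> (P l (x - l *\<^sub>R g x) - x)"
    using inner_prox_noise[OF l, of "g x" v x x] by (simp add: b_def)
  moreover have "(f x' + h x') - (f x + h x)
    \<le> (g x - v') \<bullet> (a - b) + (g x - v) \<bullet> b + al / l' * (d \<bullet> (a - b))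
      + (L / 2 - 1 / (2 * l')) * (norm a)\<^sup>2 + (1 / (2 * l') - 1 / l) * (norm b)\<^sup>2
      - 1 / (2 * l') * (norm (a - b))\<^sup>2"
    using energy_step[OF grad lip l l'(1) x _ b_def, of a al d v'] by (simp add: a_def x'_def)
  \<comment> \<open>Bias from evaluating at \<open>z\<close> plus noise of the second sample. Only
    \<open>a\<close> depends on \<open>v'\<close>, so the pairing of that noise with
    \<open>b\<close> needs no correction.\<close>
  moreover have "(g x - v') \<bullet> (a - b) = (g x - g z) \<bullet> (a - b) + (g z - v') \<bullet> a - (g z - v') \<bullet> b"
    by (simp add: inner_diff)
  ultimately show ?thesis
    unfolding a_def[symmetric] inner_diff_right[of _ _ b] by linarith
qed

text \<open>Exact and noisy steps differ by at most \<open>l * norm (y - v)\<close> by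
  nonexpansiveness, and the exact one dominates \<open>l\<close> times the residual with step size
  1.\<close>

lemma residual_le_noisy_step:
  assumes l: "0 < l" "l \<le> 1"
  shows "l * (norm (x - P 1 (x - y)))\<^sup>2 \<le> 2 / l * (norm (P l (x - l *\<^sub>R v) - x))\<^sup>2 + 2 * l * (norm (y - v))\<^sup>2"
proof -
  have "norm (P l (x - l *\<^sub>R v) - P l (x - l *\<^sub>R y)) \<le> norm (l *\<^sub>R (y - v))"
    using prox_nonexpansive[OF l(1), of "x - l *\<^sub>R v" "x - l *\<^sub>R y"] by (simp add: algebra_simps)
  moreover have "l * norm (x - P 1 (x - y)) \<le> norm (x - P l (x - l *\<^sub>R y))"
    by (rule residual_monotone[OF l])
  moreover have "norm (x - P l (x - l *\<^sub>R y)) \<le> norm (P l (x - l *\<^sub>R v) - x) + norm (P l (x - l *\<^sub>R v) - P l (x - l *\<^sub>R y))"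
    using norm_triangle_ineq4[of "P l (x - l *\<^sub>R v) - P l (x - l *\<^sub>R y)" "P l (x - l *\<^sub>R v) - x"]
    by (simp add: algebra_simps)
  ultimately have "l * norm (x - P 1 (x - y)) \<le> norm (P l (x - l *\<^sub>R v) - x) + l * norm (y - v)"
    using l by simp
  then have "(l * norm (x - P 1 (x - y)))\<^sup>2 \<le> (norm (P l (x - l *\<^sub>R v) - x) + l * norm (y - v))\<^sup>2"
    using l by (intro power_mono) auto
  also have "\<dots> \<le> 2 * (norm (P l (x - l *\<^sub>R v) - x))\<^sup>2 + 2 * (l * norm (y - v))\<^sup>2"
    using sum_squares_bound[of "norm (P l (x - l *\<^sub>R v) - x)" "l * norm (y - v)"]
    by (simp add: power2_sum)
  finally show ?thesis
    using l by (simp add: field_simps power2_eq_square)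
qed

lemma residual_lipschitz:
  assumes "L-lipschitz_on UNIV g"
  shows "(2 + L)-lipschitz_on UNIV (\<lambda>x. x - P 1 (x - g x))"
proof (rule lipschitz_onI)
  fix x y
  have g: "norm (g x - g y) \<le> L * norm (x - y)"
    using lipschitz_onD[OF assms, of x y] by (simp add: dist_norm)
  have "norm (P 1 (x - g x) - P 1 (y - g y)) \<le> norm ((x - y) - (g x - g y))"
    using prox_nonexpansive[OF zero_less_one, of "x - g x" "y - g y"] by (simp add: algebra_simps)
  also have "\<dots> \<le> norm (x - y) + norm (g x - g y)" by (rule norm_triangle_ineq4)
  finally have "norm ((x - y) - (P 1 (x - g x) - P 1 (y - g y))) \<le> 2 * norm (x - y) + norm (g x - g y)"
    using norm_triangle_ineq4[of "x - y" "P 1 (x - g x) - P 1 (y - g y)"] by linarith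
  then show "dist (x - P 1 (x - g x)) (y - P 1 (y - g y)) \<le> (2 + L) * dist x y"
    using g by (simp add: dist_norm algebra_simps)
qed (use lipschitz_on_nonneg[OF assms] in auto)

end

section \<open>Square integrable random vectors and conditional expectations\<close>

lemma AE_summable_of_summable_integral:
  fixes Y :: "nat \<Rightarrow> 'a \<Rightarrow> real"
  assumes int: "\<And>k. integrable M (Y k)" and nonneg: "\<And>k \<omega>. \<omega> \<in> space M \<Longrightarrow> 0 \<le> Y k \<omega>"
    and sum: "summable (\<lambda>k. \<integral>\<omega>. Y k \<omega> \<partial>M)"
  shows "AE \<omega> in M. summable (\<lambda>k. Y k \<omega>)"
proof -
  have [measurable]: "Y k \<in> borel_measurable M" for k using int by auto
  \<comment> \<open>Tonelli: the sum of the series has finite integral, hence is finite almost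
    everywhere.\<close>
  have "(\<integral>\<^sup>+\<omega>. (\<Sum>k. ennreal (Y k \<omega>)) \<partial>M) = (\<Sum>k. \<integral>\<^sup>+\<omega>. ennreal (Y k \<omega>) \<partial>M)"
    by (rule nn_integral_suminf) simp
  also have "\<dots> = (\<Sum>k. ennreal (\<integral>\<omega>. Y k \<omega> \<partial>M))"
    using int nonneg by (intro arg_cong[of _ _ suminf] ext nn_integral_eq_integral) auto
  also have "\<dots> = ennreal (\<Sum>k. \<integral>\<omega>. Y k \<omega> \<partial>M)"
    using nonneg sum by (intro suminf_ennreal2) auto
  finally have "(\<integral>\<^sup>+\<omega>. (\<Sum>k. ennreal (Y k \<omega>)) \<partial>M) \<noteq> \<infinity>" by simp
  then have "AE \<omega> in M. (\<Sum>k. ennreal (Y k \<omega>)) \<noteq> \<infinity>"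
    by (intro nn_integral_PInf_AE) auto
  then show ?thesis
    by (rule AE_mp) (auto intro!: AE_I2 summable_suminf_not_top nonneg)
qed

lemma borel_measurable_vec_nth':
  fixes Y :: "'a \<Rightarrow> real^'n"
  assumes "Y \<in> borel_measurable M"
  shows "(\<lambda>\<omega>. Y \<omega> $ i) \<in> borel_measurable M"
  by (rule measurable_compose[OF assms]) (auto intro!: borel_measurable_continuous_onI continuous_intros)

context prob_space
begin

definition L2 :: "('a \<Rightarrow> 'b::euclidean_space) \<Rightarrow> bool" where
  "L2 Y \<longleftrightarrow> Y \<in> borel_measurable M \<and> integrable M (\<lambda>\<omega>. (norm (Y \<omega>))\<^sup>2)"

lemma L2_measurable [measurable_dest]: "L2 Y \<Longrightarrow> Y \<in> borel_measurable M"
  by (simp add: L2_def)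

lemma L2_integrable: "L2 Y \<Longrightarrow> integrable M (\<lambda>\<omega>. (norm (Y \<omega>))\<^sup>2)"
  by (simp add: L2_def)

lemma L2_bound:
  assumes [measurable]: "Y \<in> borel_measurable M" and W: "L2 W"
    and le: "\<And>\<omega>. \<omega> \<in> space M \<Longrightarrow> (norm (Y \<omega>))\<^sup>2 \<le> A + B * (norm (W \<omega>))\<^sup>2"
  shows "L2 Y"
proof -
  have int: "integrable M (\<lambda>\<omega>. A + B * (norm (W \<omega>))\<^sup>2)"
    using L2_integrable[OF W] by auto
  have ae: "AE \<omega> in M. norm ((norm (Y \<omega>))\<^sup>2) \<le> norm (A + B * (norm (W \<omega>))\<^sup>2)"
    using le by (auto intro!: AE_I2 intro: order_trans[OF _ abs_ge_self])
  have "integrable M (\<lambda>\<omega>. (norm (Y \<omega>))\<^sup>2)"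
    by (rule Bochner_Integration.integrable_bound[OF int _ ae]) simp
  then show ?thesis by (simp add: L2_def)
qed

lemma L2_const: "L2 (\<lambda>_. c)"
  by (simp add: L2_def)

lemma L2_cong: "(\<And>\<omega>. \<omega> \<in> space M \<Longrightarrow> Y \<omega> = W \<omega>) \<Longrightarrow> L2 Y \<longleftrightarrow> L2 W"
  unfolding L2_def
  by (intro conj_cong measurable_cong Bochner_Integration.integrable_cong) auto

lemma L2_scaleR: "L2 Y \<Longrightarrow> L2 (\<lambda>\<omega>. c *\<^sub>R Y \<omega>)"
  by (rule L2_bound[of _ Y 0 "c\<^sup>2"]) (auto simp: power_mult_distrib)

lemma L2_add:
  assumes Y: "L2 Y" and W: "L2 W"
  shows "L2 (\<lambda>\<omega>. Y \<omega> + W \<omega>)"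
proof -
  have [measurable]: "Y \<in> borel_measurable M" "W \<in> borel_measurable M" using Y W by (auto dest: L2_measurable)
  have "(norm (Y \<omega> + W \<omega>))\<^sup>2 \<le> 2 * (norm (Y \<omega>))\<^sup>2 + 2 * (norm (W \<omega>))\<^sup>2" for \<omega>
  proof -
    have "(norm (Y \<omega> + W \<omega>))\<^sup>2 \<le> (norm (Y \<omega>) + norm (W \<omega>))\<^sup>2"
      by (intro power_mono norm_triangle_ineq) auto
    then show ?thesis
      using sum_squares_bound[of "norm (Y \<omega>)" "norm (W \<omega>)"] by (simp add: power2_sum)
  qed
  moreover have "integrable M (\<lambda>\<omega>. 2 * (norm (Y \<omega>))\<^sup>2 + 2 * (norm (W \<omega>))\<^sup>2)"
    using L2_integrable[OF Y] L2_integrable[OF W] by simp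
  ultimately have "integrable M (\<lambda>\<omega>. (norm (Y \<omega> + W \<omega>))\<^sup>2)"
    by (elim Bochner_Integration.integrable_bound) auto
  then show ?thesis by (simp add: L2_def)
qed

lemma L2_diff: "L2 Y \<Longrightarrow> L2 W \<Longrightarrow> L2 (\<lambda>\<omega>. Y \<omega> - W \<omega>)"
  using L2_add[of Y "\<lambda>\<omega>. (-1) *\<^sub>R W \<omega>"] L2_scaleR[of W "-1"] by simp

lemma L2_lipschitz:
  assumes G: "C-lipschitz_on UNIV G" and W: "L2 W"
  shows "L2 (\<lambda>\<omega>. G (W \<omega>))"
proof (rule L2_bound[OF _ W])
  have "G \<in> borel_measurable borel"
    using lipschitz_on_continuous_on[OF G] by (rule borel_measurable_continuous_onI)
  then show "(\<lambda>\<omega>. G (W \<omega>)) \<in> borel_measurable M"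
    using W by (auto dest: L2_measurable)
  fix \<omega>
  have "norm (G (W \<omega>) - G 0) \<le> C * norm (W \<omega>)"
    using lipschitz_onD[OF G, of "W \<omega>" 0] by (simp add: dist_norm)
  then have "norm (G (W \<omega>)) \<le> norm (G 0) + C * norm (W \<omega>)"
    using norm_triangle_ineq2[of "G (W \<omega>)" "G 0"] by linarith
  then have "(norm (G (W \<omega>)))\<^sup>2 \<le> (norm (G 0) + C * norm (W \<omega>))\<^sup>2"
    by (rule power_mono) simp
  then show "(norm (G (W \<omega>)))\<^sup>2 \<le> 2 * (norm (G 0))\<^sup>2 + 2 * C\<^sup>2 * (norm (W \<omega>))\<^sup>2"
    using sum_squares_bound[of "norm (G 0)" "C * norm (W \<omega>)"] by (simp add: power2_sum power_mult_distrib)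
qed

lemma L2_inner_integrable:
  assumes Y: "L2 Y" and W: "L2 W"
  shows "integrable M (\<lambda>\<omega>. Y \<omega> \<bullet> W \<omega>)"
proof -
  have [measurable]: "Y \<in> borel_measurable M" "W \<in> borel_measurable M" using Y W by (auto dest: L2_measurable)
  have "norm (Y \<omega> \<bullet> W \<omega>) \<le> (norm (Y \<omega>))\<^sup>2 + (norm (W \<omega>))\<^sup>2" for \<omega>
    using Cauchy_Schwarz_ineq2[of "Y \<omega>" "W \<omega>"] sum_squares_bound[of "norm (Y \<omega>)" "norm (W \<omega>)"]
      mult_nonneg_nonneg[OF norm_ge_zero norm_ge_zero, of "Y \<omega>" "W \<omega>"] by simp
  moreover have "integrable M (\<lambda>\<omega>. (norm (Y \<omega>))\<^sup>2 + (norm (W \<omega>))\<^sup>2)"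
    using L2_integrable[OF Y] L2_integrable[OF W] by simp
  ultimately show ?thesis
    by (elim Bochner_Integration.integrable_bound) auto
qed

lemma L2_component: "L2 Y \<Longrightarrow> L2 (\<lambda>\<omega>. Y \<omega> $ i)" for Y :: "'a \<Rightarrow> real^'n"
proof (rule L2_bound[of _ Y 0 1])
  assume "L2 Y"
  then have [measurable]: "Y \<in> borel_measurable M" by (rule L2_measurable)
  show "(\<lambda>\<omega>. Y \<omega> $ i) \<in> borel_measurable M" by (rule borel_measurable_vec_nth') measurable
  fix \<omega>
  have "(norm (Y \<omega> $ i))\<^sup>2 \<le> (norm (Y \<omega>))\<^sup>2"
    by (intro power_mono) (auto simp: component_le_norm_cart)
  then show "(norm (Y \<omega> $ i))\<^sup>2 \<le> 0 + 1 * (norm (Y \<omega>))\<^sup>2" by simp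
qed

lemma expectation_norm_le_sqrt:
  assumes Y: "L2 Y"
  shows "integrable M (\<lambda>\<omega>. norm (Y \<omega>))"
    and "expectation (\<lambda>\<omega>. norm (Y \<omega>)) \<le> sqrt (expectation (\<lambda>\<omega>. (norm (Y \<omega>))\<^sup>2))"
proof -
  have [measurable]: "Y \<in> borel_measurable M" using Y by (rule L2_measurable)
  show int: "integrable M (\<lambda>\<omega>. norm (Y \<omega>))"
    by (rule square_integrable_imp_integrable) (use L2_integrable[OF Y] in auto)
  \<comment> \<open>Jensen's inequality for the square, in the form that a variance is
    nonnegative.\<close>
  have "0 \<le> variance (\<lambda>\<omega>. norm (Y \<omega>))" by (rule variance_positive)
  then have "(expectation (\<lambda>\<omega>. norm (Y \<omega>)))\<^sup>2 \<le> expectation (\<lambda>\<omega>. (norm (Y \<omega>))\<^sup>2)"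
    using variance_eq[OF int L2_integrable[OF Y]] by simp
  then show "expectation (\<lambda>\<omega>. norm (Y \<omega>)) \<le> sqrt (expectation (\<lambda>\<omega>. (norm (Y \<omega>))\<^sup>2))"
    by (rule real_le_rsqrt)
qed

lemma cond_exp_subalgebra: "subalgebra M F \<Longrightarrow> sigma_finite_subalgebra M F"
  by (intro finite_measure_subalgebra_is_sigma_finite)
     (simp add: finite_measure_subalgebra_def finite_measure_axioms finite_measure_subalgebra_axioms_def)

text \<open>The tower property, by testing the conditional expectation against the constant 1. Both
  sides live in \<open>ennreal\<close> and may be infinite.\<close>

lemma nn_integral_cond_sq:
  assumes F: "subalgebra M F" and [measurable]: "Y \<in> borel_measurable M"
  shows "(\<integral>\<^sup>+\<omega>. cond_sq M F Y \<omega> \<partial>M) = (\<integral>\<^sup>+\<omega>. ennreal ((norm (Y \<omega>))\<^sup>2) \<partial>M)"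
proof -
  interpret sigma_finite_subalgebra M F by (rule cond_exp_subalgebra[OF F])
  show ?thesis
    using nn_cond_exp_intg[of "\<lambda>_. 1" "\<lambda>\<omega>. ennreal ((norm (Y \<omega>))\<^sup>2)"] by (simp add: cond_sq_def)
qed

text \<open>Square integrability comes out as a conclusion: a finite bound in \<open>ennreal\<close>
  forces it, so the conditional variance bounds also provide the second moments.\<close>

lemma L2_from_nn_integral:
  assumes Y: "Y \<in> borel_measurable M" and c: "0 \<le> c" and le: "(\<integral>\<^sup>+\<omega>. ennreal ((norm (Y \<omega>))\<^sup>2) \<partial>M) \<le> ennreal c"
  shows "L2 Y" and "expectation (\<lambda>\<omega>. (norm (Y \<omega>))\<^sup>2) \<le> c"
proof -
  note [measurable] = Y
  show L: "L2 Y"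
    unfolding L2_def using le by (auto intro!: integrableI_bounded intro: le_less_trans)
  show "expectation (\<lambda>\<omega>. (norm (Y \<omega>))\<^sup>2) \<le> c"
    using le nn_integral_eq_integral[OF L2_integrable[OF L]] c by simp
qed

lemma L2_cond_sq_const:
  assumes F: "subalgebra M F" and Y: "Y \<in> borel_measurable M" and c: "0 \<le> c"
    and le: "AE \<omega> in M. cond_sq M F Y \<omega> \<le> ennreal c"
  shows "L2 Y" and "expectation (\<lambda>\<omega>. (norm (Y \<omega>))\<^sup>2) \<le> c"
proof -
  have "(\<integral>\<^sup>+\<omega>. cond_sq M F Y \<omega> \<partial>M) \<le> (\<integral>\<^sup>+\<omega>. ennreal c \<partial>M)"
    by (rule nn_integral_mono_AE[OF le])
  then have "(\<integral>\<^sup>+\<omega>. ennreal ((norm (Y \<omega>))\<^sup>2) \<partial>M) \<le> ennreal c"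
    by (simp add: nn_integral_cond_sq[OF F Y] emeasure_space_1)
  from L2_from_nn_integral[OF Y c this] show "L2 Y" "expectation (\<lambda>\<omega>. (norm (Y \<omega>))\<^sup>2) \<le> c" by auto
qed

lemma L2_cond_sq_le:
  assumes F: "subalgebra M F" and Y: "Y \<in> borel_measurable M" and W: "L2 W" and c: "0 \<le> c"
    and le: "AE \<omega> in M. cond_sq M F Y \<omega> \<le> ennreal c * cond_sq M F W \<omega>"
  shows "L2 Y" and "expectation (\<lambda>\<omega>. (norm (Y \<omega>))\<^sup>2) \<le> c * expectation (\<lambda>\<omega>. (norm (W \<omega>))\<^sup>2)"
proof -
  have Wm[measurable]: "W \<in> borel_measurable M" using W by (rule L2_measurable)
  have "(\<integral>\<^sup>+\<omega>. cond_sq M F Y \<omega> \<partial>M) \<le> (\<integral>\<^sup>+\<omega>. ennreal c * cond_sq M F W \<omega> \<partial>M)"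
    by (rule nn_integral_mono_AE[OF le])
  also have "\<dots> = ennreal c * (\<integral>\<^sup>+\<omega>. cond_sq M F W \<omega> \<partial>M)"
    unfolding cond_sq_def by (intro nn_integral_cmult) simp
  also have "\<dots> = ennreal (c * expectation (\<lambda>\<omega>. (norm (W \<omega>))\<^sup>2))"
    using c by (simp add: nn_integral_cond_sq[OF F Wm] nn_integral_eq_integral[OF L2_integrable[OF W]] ennreal_mult)
  finally have "(\<integral>\<^sup>+\<omega>. ennreal ((norm (Y \<omega>))\<^sup>2) \<partial>M) \<le> ennreal (c * expectation (\<lambda>\<omega>. (norm (W \<omega>))\<^sup>2))"
    by (simp add: nn_integral_cond_sq[OF F Y])
  from L2_from_nn_integral[OF Y _ this] c show "L2 Y" "expectation (\<lambda>\<omega>. (norm (Y \<omega>))\<^sup>2) \<le> c * expectation (\<lambda>\<omega>. (norm (W \<omega>))\<^sup>2)"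
    by auto
qed

text \<open>\<open>W\<close> is known given \<open>F\<close>, so \<open>V\<close> may be replaced by
  its conditional mean. This is done by coordinates, as in \<open>vec_cond_exp\<close>; square
  integrability of both factors makes the products integrable.\<close>

lemma expectation_noise_inner:
  fixes V W g :: "'a \<Rightarrow> real^'n"
  assumes F: "subalgebra M F" and V: "L2 V" and g: "L2 g" and W: "L2 W" "W \<in> borel_measurable F"
    and mean: "AE \<omega> in M. vec_cond_exp M F V \<omega> = g \<omega>"
  shows "expectation (\<lambda>\<omega>. (g \<omega> - V \<omega>) \<bullet> W \<omega>) = 0"
proof -
  interpret sigma_finite_subalgebra M F by (rule cond_exp_subalgebra[OF F])
  have [measurable]: "V \<in> borel_measurable M" "W \<in> borel_measurable M" "g \<in> borel_measurable M"
    using V W g by (auto dest: L2_measurable)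
  have intV: "integrable M (\<lambda>\<omega>. W \<omega> $ i * V \<omega> $ i)" for i
    using L2_inner_integrable[OF L2_component[OF W(1)] L2_component[OF V], of i i] by simp
  have intg: "integrable M (\<lambda>\<omega>. W \<omega> $ i * g \<omega> $ i)" for i
    using L2_inner_integrable[OF L2_component[OF W(1)] L2_component[OF g], of i i] by simp
  have Wi: "(\<lambda>\<omega>. W \<omega> $ i) \<in> borel_measurable F" for i
    using W(2) by (rule borel_measurable_vec_nth')
  have Vi: "(\<lambda>\<omega>. V \<omega> $ i) \<in> borel_measurable M" for i
    by (rule borel_measurable_vec_nth') measurable
  note [measurable] = borel_measurable_vec_nth'
  have "expectation (\<lambda>\<omega>. W \<omega> $ i * V \<omega> $ i) = expectation (\<lambda>\<omega>. W \<omega> $ i * real_cond_exp M F (\<lambda>\<omega>. V \<omega> $ i) \<omega>)" for i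
    using real_cond_exp_intg(2)[OF intV Wi Vi] by simp
  also have "expectation (\<lambda>\<omega>. W \<omega> $ i * real_cond_exp M F (\<lambda>\<omega>. V \<omega> $ i) \<omega>) = expectation (\<lambda>\<omega>. W \<omega> $ i * g \<omega> $ i)" for i
  proof (rule integral_cong_AE)
    show "AE \<omega> in M. W \<omega> $ i * real_cond_exp M F (\<lambda>\<omega>. V \<omega> $ i) \<omega> = W \<omega> $ i * g \<omega> $ i"
      using mean by eventually_elim (auto simp: vec_cond_exp_def vec_eq_iff)
  qed measurable
  finally have eq: "expectation (\<lambda>\<omega>. W \<omega> $ i * V \<omega> $ i) = expectation (\<lambda>\<omega>. W \<omega> $ i * g \<omega> $ i)" for i .
  have "(\<lambda>\<omega>. (g \<omega> - V \<omega>) \<bullet> W \<omega>) = (\<lambda>\<omega>. \<Sum>i\<in>UNIV. W \<omega> $ i * g \<omega> $ i - W \<omega> $ i * V \<omega> $ i)"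
    by (simp add: inner_vec_def algebra_simps)
  then show ?thesis
    using intV intg eq by simp
qed

end

section \<open>One step of the method in expectation\<close>

locale stochastic_prox = convex_lsc_proper \<phi> + prob_space M
  for \<phi> :: "real^'n \<Rightarrow> ereal" and M :: "'w measure" +
  fixes f :: "real^'n \<Rightarrow> real" and g :: "real^'n \<Rightarrow> real^'n" and L :: real
  assumes grad: "\<And>x. GDERIV f x :> g x" and lip: "L-lipschitz_on UNIV g" and L: "1 \<le> L"
begin

abbreviation res :: "real^'n \<Rightarrow> real^'n" where
  "res x \<equiv> x - P 1 (x - g x)"

abbreviation psi :: "real^'n \<Rightarrow> real" where
  "psi x \<equiv> f x + h x"

lemma prox_lipschitz: "0 < l \<Longrightarrow> 1-lipschitz_on UNIV (P l)"
  by (intro lipschitz_onI) (auto simp: dist_norm prox_nonexpansive)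

lemma measurable_lipschitz:
  fixes G :: "real^'n \<Rightarrow> real^'n"
  shows "C-lipschitz_on UNIV G \<Longrightarrow> G \<in> borel_measurable borel"
  using lipschitz_on_continuous_on by (rule borel_measurable_continuous_onI)

text \<open>\<open>G\<close> stands for the information before the step and \<open>F\<close> for
  that after drawing \<open>v\<close>; \<open>v'\<close> is drawn last. The increase of
  \<open>psi\<close> is only bounded by an integrable \<open>T\<close>, so that these bounds can be
  added along a path before integrating.\<close>

lemma stochastic_extra_step:
  fixes x d v v' x' z :: "'w \<Rightarrow> real^'n"
  assumes F: "subalgebra M F" and G: "subalgebra F G"
    and x: "x \<in> borel_measurable G" "L2 x" "\<And>\<omega>. \<omega> \<in> space M \<Longrightarrow> x \<omega> \<in> eff_dom \<phi>"
    and v: "v \<in> borel_measurable F" and v': "v' \<in> borel_measurable M" and d: "d \<in> borel_measurable F"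
    and z: "\<And>\<omega>. \<omega> \<in> space M \<Longrightarrow> z \<omega> = x \<omega> + be *\<^sub>R d \<omega>"
    and x': "\<And>\<omega>. \<omega> \<in> space M \<Longrightarrow> x' \<omega> = P l' (x \<omega> + al *\<^sub>R d \<omega> - l' *\<^sub>R v' \<omega>)"
    and nonneg: "0 \<le> al" "0 \<le> be" and l: "0 < l" and l': "0 < l'" "l' \<le> (1 - r) / L"
    and r: "0 < r" "r < 1"
    and l_le: "l \<le> (1 - r) * l' / (1 + \<nu>\<^sup>2 * (al + L * be * l')\<^sup>2)"
    and d_sq: "AE \<omega> in M. cond_sq M G d \<omega>
       \<le> ennreal (\<nu>\<^sup>2) * cond_sq M G (\<lambda>\<omega>. x \<omega> - P l (x \<omega> - l *\<^sub>R v \<omega>)) \<omega>"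
    and mean: "AE \<omega> in M. vec_cond_exp M G v \<omega> = g (x \<omega>)" "AE \<omega> in M. vec_cond_exp M F v' \<omega> = g (z \<omega>)"
    and var: "AE \<omega> in M. cond_sq M G (\<lambda>\<omega>. g (x \<omega>) - v \<omega>) \<omega> \<le> ennreal (s\<^sup>2)"
      "AE \<omega> in M. cond_sq M F (\<lambda>\<omega>. g (z \<omega>) - v' \<omega>) \<omega> \<le> ennreal (s'\<^sup>2)"
  shows "L2 x'"
    and "\<exists>T. integrable M T \<and> (\<forall>\<omega>\<in>space M. psi (x' \<omega>) - psi (x \<omega>) \<le> T \<omega>) \<and>
      expectation T \<le> l' * s'\<^sup>2 + 2 * (l * s\<^sup>2) - r / (2 * l') * expectation (\<lambda>\<omega>. (norm (x' \<omega> - x \<omega>))\<^sup>2)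
        - l / 4 * expectation (\<lambda>\<omega>. (norm (res (x \<omega>)))\<^sup>2)"
proof -
  have MG: "subalgebra M G" using F G by (auto simp: subalgebra_def)
  have P: "L2 (\<lambda>\<omega>. P t (W \<omega>))" if "L2 W" "0 < t" for W and t :: real
    using L2_lipschitz[OF prox_lipschitz[OF that(2)] that(1)] .
  have g: "L2 (\<lambda>\<omega>. g (W \<omega>))" if "L2 W" for W
    using L2_lipschitz[OF lip that] .
  note L2s = L2_add L2_diff L2_scaleR P g
  have Pm[measurable]: "P t \<in> borel_measurable borel" if "0 < t" for t
    using measurable_lipschitz[OF prox_lipschitz[OF that]] .
  note gm[measurable] = measurable_lipschitz[OF lip]
  have xF[measurable]: "x \<in> borel_measurable F" by (rule measurable_from_subalg[OF G x(1)])
  note [measurable] = measurable_from_subalg[OF F xF] v d v' measurable_from_subalg[OF F v] measurable_from_subalg[OF F d]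
  define b where "b \<omega> = P l (x \<omega> - l *\<^sub>R v \<omega>) - x \<omega>" for \<omega>
  define bb where "bb \<omega> = P l (x \<omega> - l *\<^sub>R g (x \<omega>)) - x \<omega>" for \<omega>
  define a where "a \<omega> = x' \<omega> - x \<omega>" for \<omega>
  \<comment> \<open>With the exact gradient in place of \<open>v'\<close> this is
    \<open>F\<close>-measurable; \<open>b\<close> depends on \<open>v\<close>, which is known by
    then. Likewise \<open>bb\<close> is \<open>G\<close>-measurable.\<close>
  define aa where "aa \<omega> = P l' (x \<omega> + al *\<^sub>R d \<omega> - l' *\<^sub>R g (x \<omega> + be *\<^sub>R d \<omega>)) - x \<omega> - b \<omega>" for \<omega>
  define n where "n \<omega> = g (x \<omega>) - v \<omega>" for \<omega>
  define n' where "n' \<omega> = g (x \<omega> + be *\<^sub>R d \<omega>) - v' \<omega>" for \<omega>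
  define c where "c = (al + L * be * l')\<^sup>2"

  \<comment> \<open>Square integrability passes along \<open>n\<close>, \<open>v\<close>,
    \<open>b\<close>, \<open>d\<close>, \<open>n'\<close>, \<open>v'\<close>, \<open>x'\<close>: the
    variance bounds give the errors, the growth condition gives \<open>d\<close>, and Lipschitz maps
    give the rest.\<close>
  have n: "L2 n" "expectation (\<lambda>\<omega>. (norm (n \<omega>))\<^sup>2) \<le> s\<^sup>2"
    using L2_cond_sq_const[OF MG, of n "s\<^sup>2"] var(1) by (auto simp: n_def[abs_def])
  have vL: "L2 v"
    using L2_diff[OF g[OF x(2)] n(1)] by (simp add: n_def)
  have bL: "L2 b"
    unfolding b_def[abs_def] using l by (intro L2s x vL)
  have bL': "L2 (\<lambda>\<omega>. - b \<omega>)" using L2_scaleR[OF bL, of "-1"] by simp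
  have d_sq': "AE \<omega> in M. cond_sq M G d \<omega> \<le> ennreal (\<nu>\<^sup>2) * cond_sq M G (\<lambda>\<omega>. - b \<omega>) \<omega>"
    using d_sq by (simp add: b_def)
  have dL: "L2 d" and d_le: "expectation (\<lambda>\<omega>. (norm (d \<omega>))\<^sup>2) \<le> \<nu>\<^sup>2 * expectation (\<lambda>\<omega>. (norm (b \<omega>))\<^sup>2)"
    using L2_cond_sq_le[OF MG _ bL', of d "\<nu>\<^sup>2"] d_sq' by auto
  have zL: "L2 (\<lambda>\<omega>. x \<omega> + be *\<^sub>R d \<omega>)"
    by (intro L2s x dL)
  have n'_eq: "n' \<omega> = g (z \<omega>) - v' \<omega>" if "\<omega> \<in> space M" for \<omega>
    using z[OF that] by (simp add: n'_def)
  have n'm[measurable]: "n' \<in> borel_measurable M"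
    by (simp add: n'_def[abs_def])
  \<comment> \<open>The variance bound speaks of \<open>z\<close>, which is known to equal
    \<open>x + be * d\<close> only on \<open>space M\<close>; it is transferred along that
    equality.\<close>
  define q where "q \<omega> = g (z \<omega>) - v' \<omega>" for \<omega>
  have [measurable]: "q \<in> borel_measurable M"
    using n'm n'_eq measurable_cong[of M n' q borel] by (simp add: q_def)
  have "AE \<omega> in M. ennreal ((norm (n' \<omega>))\<^sup>2) = ennreal ((norm (q \<omega>))\<^sup>2)"
    by (intro AE_I2) (simp add: n'_eq q_def)
  then have "AE \<omega> in M. cond_sq M F n' \<omega> = cond_sq M F q \<omega>"
    unfolding cond_sq_def
    by (intro sigma_finite_subalgebra.nn_cond_exp_cong[OF cond_exp_subalgebra[OF F]]) measurable
  then have "AE \<omega> in M. cond_sq M F n' \<omega> \<le> ennreal (s'\<^sup>2)"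
    using var(2) unfolding q_def[abs_def] by eventually_elim simp
  from L2_cond_sq_const[OF F n'm _ this]
  have n': "L2 n'" "expectation (\<lambda>\<omega>. (norm (n' \<omega>))\<^sup>2) \<le> s'\<^sup>2"
    by auto
  have v'L: "L2 v'"
    using L2_diff[OF g[OF zL] n'(1)] by (simp add: n'_def)
  have "L2 (\<lambda>\<omega>. P l' (x \<omega> + al *\<^sub>R d \<omega> - l' *\<^sub>R v' \<omega>))"
    using l' by (intro L2s x dL v'L)
  then show x'L: "L2 x'"
    using L2_cong[of x' "\<lambda>\<omega>. P l' (x \<omega> + al *\<^sub>R d \<omega> - l' *\<^sub>R v' \<omega>)"] x' by simp
  have aL: "L2 a" unfolding a_def[abs_def] by (intro L2s x x'L)
  have bbL: "L2 bb" unfolding bb_def[abs_def] using l by (intro L2s x)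
  have aaL: "L2 aa" unfolding aa_def[abs_def] using l' by (intro L2s x zL dL bL)

  have "bb \<in> borel_measurable G"
    unfolding bb_def[abs_def] using x(1) l by measurable
  then have bb0: "expectation (\<lambda>\<omega>. n \<omega> \<bullet> bb \<omega>) = 0"
    unfolding n_def[abs_def] using expectation_noise_inner[OF MG vL g[OF x(2)] bbL _ mean(1)] by simp
  have "aa \<in> borel_measurable F"
    unfolding aa_def[abs_def] b_def[abs_def] using l l'(1) by measurable
  moreover have "AE \<omega> in M. vec_cond_exp M F v' \<omega> = g (x \<omega> + be *\<^sub>R d \<omega>)"
    using mean(2) AE_space by eventually_elim (simp add: z)
  ultimately have aa0: "expectation (\<lambda>\<omega>. n' \<omega> \<bullet> aa \<omega>) = 0"
    unfolding n'_def[abs_def] using expectation_noise_inner[OF F v'L g[OF zL] aaL] by simp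

  have c0: "0 < 1 + \<nu>\<^sup>2 * c" by (simp add: c_def add_pos_nonneg)
  have l_c: "l * (1 + \<nu>\<^sup>2 * c) \<le> (1 - r) * l'"
    using l_le c0 by (simp add: c_def pos_le_divide_eq)
  \<comment> \<open>The step-size condition makes the cost of \<open>d\<close> together with the
    positive term \<open>1 / (2 * l')\<close> fit into half of \<open>1 / l\<close>, so a gain of
    \<open>1 / (2 * l)\<close> times the second moment of \<open>b\<close> remains.\<close>
  note l_c
  also have "(1 - r) * l' \<le> 1 * l'" using r l' by (intro mult_right_mono) auto
  finally have lc: "(1 + \<nu>\<^sup>2 * c) / (2 * l') \<le> 1 / (2 * l)"
    using l l'(1) by (simp add: field_simps)
  have "l * 1 \<le> l * (1 + \<nu>\<^sup>2 * c)"
    using l c0 by (intro mult_left_mono) (auto simp: c_def)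
  also note l_c
  also have "(1 - r) * l' \<le> 1 * ((1 - r) / L)"
    using r l' by (intro mult_mono) auto
  also have "\<dots> \<le> 1" using r L by (simp add: divide_le_eq)
  finally have l1: "l \<le> 1" by simp
  have Ll': "L * l' \<le> 1 - r" using l'(2) L by (simp add: pos_le_divide_eq mult.commute)

  define T where "T \<omega> = l' * (norm (n' \<omega>))\<^sup>2 + l * (norm (n \<omega>))\<^sup>2 + n' \<omega> \<bullet> aa \<omega> + n \<omega> \<bullet> bb \<omega>
      + c / (2 * l') * (norm (d \<omega>))\<^sup>2 - r / (2 * l') * (norm (a \<omega>))\<^sup>2
      + (1 / (2 * l') - 1 / l) * (norm (b \<omega>))\<^sup>2" for \<omega>
  note ints = L2_integrable[OF n(1)] L2_integrable[OF n'(1)] L2_integrable[OF dL] L2_integrable[OF aL] L2_integrable[OF bL]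
    L2_inner_integrable[OF n'(1) aaL] L2_inner_integrable[OF n(1) bbL]
  have "integrable M T" unfolding T_def[abs_def] using ints by simp
  moreover have "psi (x' \<omega>) - psi (x \<omega>) \<le> T \<omega>" if "\<omega> \<in> space M" for \<omega>
    using energy_step_noise[OF grad lip l l'(1) Ll' nonneg x(3)[OF that] x'[OF that] refl refl, of "v \<omega>"]
    by (simp add: T_def n_def n'_def aa_def bb_def a_def b_def c_def)
  moreover have "expectation T \<le> l' * s'\<^sup>2 + 2 * (l * s\<^sup>2) - r / (2 * l') * expectation (\<lambda>\<omega>. (norm (a \<omega>))\<^sup>2)
        - l / 4 * expectation (\<lambda>\<omega>. (norm (res (x \<omega>)))\<^sup>2)"
  proof -
    define EN EN' ED EA EB ER where "EN = expectation (\<lambda>\<omega>. (norm (n \<omega>))\<^sup>2)"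
      and "EN' = expectation (\<lambda>\<omega>. (norm (n' \<omega>))\<^sup>2)" and "ED = expectation (\<lambda>\<omega>. (norm (d \<omega>))\<^sup>2)"
      and "EA = expectation (\<lambda>\<omega>. (norm (a \<omega>))\<^sup>2)" and "EB = expectation (\<lambda>\<omega>. (norm (b \<omega>))\<^sup>2)"
      and "ER = expectation (\<lambda>\<omega>. (norm (res (x \<omega>)))\<^sup>2)"
    note E_defs = EN_def EN'_def ED_def EA_def EB_def ER_def
    have "expectation T = l' * EN' + l * EN + c / (2 * l') * ED - r / (2 * l') * EA + (1 / (2 * l') - 1 / l) * EB"
      unfolding T_def[abs_def] E_defs using ints aa0 bb0 by simp
    moreover have "l' * EN' \<le> l' * s'\<^sup>2" "l * EN \<le> l * s\<^sup>2"
      using n n' l l' by (auto simp: E_defs)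
    moreover have "c / (2 * l') * ED \<le> c / (2 * l') * (\<nu>\<^sup>2 * EB)"
      using d_le l' by (intro mult_left_mono) (auto simp: E_defs c_def)
    moreover have "(1 + \<nu>\<^sup>2 * c) / (2 * l') * EB \<le> 1 / (2 * l) * EB"
      using lc by (intro mult_right_mono) (auto simp: E_defs)
    \<comment> \<open>A quarter of this trades the remaining \<open>1 / (2 * l) * EB\<close> for
      \<open>l / 4 * ER\<close> at the price \<open>l / 2 * EN\<close>. The first noise then costs
      \<open>3 / 2\<close> times \<open>l * s\<^sup>2\<close>, rounded up to 2.\<close>
    moreover have "l * ER \<le> 2 / l * EB + 2 * l * EN"
    proof -
      have "expectation (\<lambda>\<omega>. l * (norm (res (x \<omega>)))\<^sup>2) \<le> expectation (\<lambda>\<omega>. 2 / l * (norm (b \<omega>))\<^sup>2 + 2 * l * (norm (n \<omega>))\<^sup>2)"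
        using L2_integrable[OF L2_lipschitz[OF residual_lipschitz[OF lip] x(2)]] ints
          residual_le_noisy_step[OF l l1]
        by (intro integral_mono) (auto simp: b_def n_def)
      then show ?thesis
        unfolding E_defs using L2_integrable[OF L2_lipschitz[OF residual_lipschitz[OF lip] x(2)]] ints by simp
    qed
    moreover have "(1 + \<nu>\<^sup>2 * c) / (2 * l') * EB = 1 / (2 * l') * EB + c / (2 * l') * (\<nu>\<^sup>2 * EB)"
      by (simp add: add_divide_distrib algebra_simps)
    moreover have "(1 / (2 * l') - 1 / l) * EB = 1 / (2 * l') * EB - 2 * (1 / (2 * l) * EB)"
      by (simp add: algebra_simps)
    moreover have "2 / l * EB = 4 * (1 / (2 * l) * EB)" by simp
    moreover have "l / 4 * ER = 1 / 4 * (l * ER)" "2 * l * EN = 2 * (l * EN)" by simp_all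
    moreover have "0 \<le> l * s\<^sup>2" using l by simp
    ultimately show ?thesis
      unfolding E_defs[symmetric] by linarith
  qed
  ultimately show "\<exists>T. integrable M T \<and> (\<forall>\<omega>\<in>space M. psi (x' \<omega>) - psi (x \<omega>) \<le> T \<omega>) \<and>
      expectation T \<le> l' * s'\<^sup>2 + 2 * (l * s\<^sup>2) - r / (2 * l') * expectation (\<lambda>\<omega>. (norm (x' \<omega> - x \<omega>))\<^sup>2)
        - l / 4 * expectation (\<lambda>\<omega>. (norm (res (x \<omega>)))\<^sup>2)"
    unfolding a_def by blast
qed

end

section \<open>The filtrations of the method\<close>

lemma sets_vimage_algebra_Pow: "sets (vimage_algebra A Y N) \<subseteq> Pow A"
  using sets.space_closed[of "vimage_algebra A Y N"] by simp

lemma filt_generators_Pow: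
  "(\<Union>i\<in>{..k}. sets (vimage_algebra (space M) (V i) borel)) \<union>
      (\<Union>i\<in>{..<k}. sets (vimage_algebra (space M) (Vp i) borel)) \<subseteq> Pow (space M)"
  by (intro Un_least UN_least sets_vimage_algebra_Pow)

lemma space_filt [simp]: "space (filt M V Vp k) = space M"
  unfolding filt_def by (rule space_measure_of[OF filt_generators_Pow])

lemma sets_filt:
  "sets (filt M V Vp k) = sigma_sets (space M)
     ((\<Union>i\<in>{..k}. sets (vimage_algebra (space M) (V i) borel)) \<union>
      (\<Union>i\<in>{..<k}. sets (vimage_algebra (space M) (Vp i) borel)))"
  unfolding filt_def by (rule sets_measure_of[OF filt_generators_Pow])

lemma filt_plus_generators_Pow:
  "sets (filt M V Vp k) \<union> sets (vimage_algebra (space M) (Vp k) borel) \<subseteq> Pow (space M)"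
  using sets.space_closed[of "filt M V Vp k"] by (intro Un_least sets_vimage_algebra_Pow) simp

lemma space_filt_plus [simp]: "space (filt_plus M V Vp k) = space M"
  unfolding filt_plus_def by (rule space_measure_of[OF filt_plus_generators_Pow])

lemma sets_filt_plus:
  "sets (filt_plus M V Vp k) = sigma_sets (space M)
     (sets (filt M V Vp k) \<union> sets (vimage_algebra (space M) (Vp k) borel))"
  unfolding filt_plus_def by (rule sets_measure_of[OF filt_plus_generators_Pow])

lemma space_filt_prev [simp]: "space (filt_prev M V Vp k) = space M"
  by (simp add: filt_prev_def split: nat.split)

text \<open>\<open>N\<close> is left free to serve twice: with \<open>M\<close> itself, and with a
  later stage for monotonicity.\<close>

lemma subalgebra_filtI:
  assumes "space N = space M"
    and "\<And>i. i \<le> k \<Longrightarrow> sets (vimage_algebra (space M) (V i) borel) \<subseteq> sets N"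
    and "\<And>i. i < k \<Longrightarrow> sets (vimage_algebra (space M) (Vp i) borel) \<subseteq> sets N"
  shows "subalgebra N (filt M V Vp k)"
  unfolding subalgebra_def
proof (intro conjI)
  show "sets (filt M V Vp k) \<subseteq> sets N"
    unfolding sets_filt assms(1)[symmetric]
    by (rule sets.sigma_sets_subset, unfold assms(1), intro Un_least UN_least assms(2,3)) auto
qed (simp add: assms(1))

lemma subalgebra_filt:
  assumes "\<And>k. V k \<in> borel_measurable M" "\<And>k. Vp k \<in> borel_measurable M"
  shows "subalgebra M (filt M V Vp k)"
  by (intro subalgebra_filtI sets_image_in_sets assms refl)

lemma subalgebra_filt_plus: "subalgebra (filt_plus M V Vp k) (filt M V Vp k)"
  by (auto simp: subalgebra_def sets_filt_plus)

lemma measurable_filt: "V k \<in> borel_measurable (filt M V Vp k)"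
proof -
  have "V k \<in> measurable (vimage_algebra (space M) (V k) borel) borel"
    by (rule measurable_vimage_algebra1) auto
  moreover have "subalgebra (filt M V Vp k) (vimage_algebra (space M) (V k) borel)"
    by (auto simp: subalgebra_def sets_filt)
  ultimately show ?thesis by (rule measurable_from_subalg[rotated])
qed

lemma measurable_filt_plus: "Vp k \<in> borel_measurable (filt_plus M V Vp k)"
proof -
  have "Vp k \<in> measurable (vimage_algebra (space M) (Vp k) borel) borel"
    by (rule measurable_vimage_algebra1) auto
  moreover have "subalgebra (filt_plus M V Vp k) (vimage_algebra (space M) (Vp k) borel)"
    by (auto simp: subalgebra_def sets_filt_plus)
  ultimately show ?thesis by (rule measurable_from_subalg[rotated])
qed

lemma subalgebra_filt_prev: "subalgebra (filt M V Vp k) (filt_prev M V Vp k)"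
proof (cases k)
  case 0
  have "sets (sigma (space M) {}) \<subseteq> sets (filt M V Vp 0)"
    using sets.top[of "filt M V Vp 0"] by (simp add: sigma_sets_empty_eq)
  then show ?thesis by (simp add: 0 filt_prev_def subalgebra_def)
next
  case (Suc j)
  have gen: "sets (vimage_algebra (space M) (V i) borel) \<subseteq> sets (filt M V Vp (Suc j))" if "i \<le> Suc j" for i
    using that by (auto simp: sets_filt)
  have gen': "sets (vimage_algebra (space M) (Vp i) borel) \<subseteq> sets (filt M V Vp (Suc j))" if "i < Suc j" for i
    using that by (auto simp: sets_filt)
  have "sets (filt M V Vp j) \<subseteq> sets (filt M V Vp (Suc j))"
    using subalgebra_filtI[of "filt M V Vp (Suc j)" M j V Vp] gen gen' by (simp add: subalgebra_def)
  then have "sets (filt_plus M V Vp j) \<subseteq> sets (filt M V Vp (Suc j))"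
    using sets.sigma_sets_subset[of "sets (filt M V Vp j) \<union> sets (vimage_algebra (space M) (Vp j) borel)"
        "filt M V Vp (Suc j)"] gen'[of j]
    by (simp add: sets_filt_plus)
  then show ?thesis by (simp add: Suc filt_prev_def subalgebra_def)
qed

section \<open>Summation over the steps and convergence of the residual\<close>

theorem theorem3p3:
  fixes f :: "real^'n \<Rightarrow> real" and gradf :: "real^'n \<Rightarrow> real^'n"
    and \<phi> :: "real^'n \<Rightarrow> ereal"
    and M :: "'w measure"
    and x0 :: "real^'n"
    and X Z D V Vp :: "nat \<Rightarrow> 'w \<Rightarrow> real^'n"
    and \<alpha> \<beta> lam lamp \<nu> \<sigma> \<sigma>p :: "nat \<Rightarrow> real"
    and \<Lambda> \<Lambda>p :: "nat \<Rightarrow> real^'n^'n"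
    and Lf rho_bar rho_low :: real
  assumes grad: "\<And>x. GDERIV f x :> gradf x"
    and grad_cont: "continuous_on UNIV gradf"
    and phi: "convex_fun \<phi>" "lsc_fun \<phi>" "proper_fun \<phi>"
    and prob: "prob_space M"
    and x0_dom: "x0 \<in> eff_dom \<phi>"
    and steps_nonneg: "\<And>k. 0 \<le> \<alpha> k" "\<And>k. 0 \<le> \<beta> k"
    and lam_pos: "\<And>k. 0 < lam k" "\<And>k. 0 < lamp k"
    and Lambda: "\<And>k. \<Lambda> k = inverse (lam k) *\<^sub>R mat 1"
      "\<And>k. \<Lambda>p k = inverse (lamp k) *\<^sub>R mat 1"
    and V_rv: "\<And>k. V k \<in> borel_measurable M" "\<And>k. Vp k \<in> borel_measurable M"
    and X_init: "\<And>\<omega>. \<omega> \<in> space M \<Longrightarrow> X 0 \<omega> = x0"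
    and Z_step: "\<And>k \<omega>. \<omega> \<in> space M \<Longrightarrow> Z k \<omega> = X k \<omega> + \<beta> k *\<^sub>R D k \<omega>"
    and X_step: "\<And>k \<omega>. \<omega> \<in> space M \<Longrightarrow>
      X (Suc k) \<omega> = prox \<phi> (\<Lambda>p k) (X k \<omega> + \<alpha> k *\<^sub>R D k \<omega> - matrix_inv (\<Lambda>p k) *v Vp k \<omega>)"
    and A1: "1 \<le> Lf" "Lf-lipschitz_on UNIV gradf"
    and A2: "\<exists>m::real. \<forall>x\<in>eff_dom \<phi>. ereal m \<le> ereal (f x) + \<phi> x"
    and B1: "\<And>k. D k \<in> borel_measurable (filt M V Vp k)"
    and B2: "\<And>k. 0 < \<nu> k"
      "\<And>k. AE \<omega> in M. cond_sq M (filt_prev M V Vp k) (D k) \<omega>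
         \<le> ennreal ((\<nu> k)\<^sup>2) *
           cond_sq M (filt_prev M V Vp k) (\<lambda>\<omega>'. prox_residual \<phi> (\<Lambda> k) (V k \<omega>') (X k \<omega>')) \<omega>"
    and B3_mean:
      "\<And>k. AE \<omega> in M. vec_cond_exp M (filt_prev M V Vp k) (V k) \<omega> = gradf (X k \<omega>)"
      "\<And>k. AE \<omega> in M. vec_cond_exp M (filt M V Vp k) (Vp k) \<omega> = gradf (Z k \<omega>)"
    and B3_var: "\<And>k. 0 < \<sigma> k" "\<And>k. 0 < \<sigma>p k"
      "\<And>k. AE \<omega> in M. cond_sq M (filt_prev M V Vp k) (\<lambda>\<omega>'. gradf (X k \<omega>') - V k \<omega>') \<omega>
         \<le> ennreal ((\<sigma> k)\<^sup>2)"
      "\<And>k. AE \<omega> in M. cond_sq M (filt M V Vp k) (\<lambda>\<omega>'. gradf (Z k \<omega>') - Vp k \<omega>') \<omega>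
         \<le> ennreal ((\<sigma>p k)\<^sup>2)"
    and rho: "0 < rho_bar" "rho_bar < 1" "0 < rho_low" "rho_low < 1"
    and step_bounds: "\<And>k. lamp k \<le> (1 - rho_bar) / Lf"
      "\<And>k. lam k \<le> (1 - rho_bar) * lamp k / (1 + (\<nu> k)\<^sup>2 * (\<alpha> k + Lf * \<beta> k * lamp k)\<^sup>2)"
      "\<And>k. rho_low * lamp k \<le> lam k"
    and sums: "filterlim (\<lambda>n. \<Sum>k<n. lam k) at_top sequentially"
      "summable (\<lambda>k. lam k * (\<sigma> k)\<^sup>2)"
      "summable (\<lambda>k. lamp k * (\<sigma>p k)\<^sup>2)"
  shows "(\<forall>k. integrable M (\<lambda>\<omega>. norm (prox_residual \<phi> (mat 1) (gradf (X k \<omega>)) (X k \<omega>))))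
    \<and> (\<lambda>k. \<integral>\<omega>. norm (prox_residual \<phi> (mat 1) (gradf (X k \<omega>)) (X k \<omega>)) \<partial>M) \<longlonglongrightarrow> 0
    \<and> (AE \<omega> in M. (\<lambda>k. prox_residual \<phi> (mat 1) (gradf (X k \<omega>)) (X k \<omega>)) \<longlonglongrightarrow> 0)"
proof -
  interpret stochastic_prox \<phi> M f gradf Lf
    by (intro stochastic_prox.intro convex_lsc_proper.intro stochastic_prox_axioms.intro phi prob grad A1)
  have lam1: "lam k \<le> lamp k" "lamp k \<le> 1" for k
  proof -
    have "lam k \<le> (1 - rho_bar) * lamp k / (1 + (\<nu> k)\<^sup>2 * (\<alpha> k + Lf * \<beta> k * lamp k)\<^sup>2)"
      by (rule step_bounds)
    also have "\<dots> \<le> (1 - rho_bar) * lamp k / 1"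
      using rho lam_pos(2)[of k] by (intro divide_left_mono) (auto simp: add_pos_nonneg intro!: mult_nonneg_nonneg)
    also have "\<dots> \<le> lamp k" using rho lam_pos(2)[of k] by (simp add: mult_left_le_one_le)
    finally show "lam k \<le> lamp k" .
    have "(1 - rho_bar) / Lf \<le> 1 / 1"
      using rho A1(1) by (intro frac_le) auto
    then show "lamp k \<le> 1" using step_bounds(1)[of k] by linarith
  qed
  have F: "subalgebra M (filt M V Vp k)" for k
    by (rule subalgebra_filt[OF V_rv])
  have dom: "X k \<omega> \<in> eff_dom \<phi>" if "\<omega> \<in> space M" for k \<omega>
    using that by (cases k) (auto simp: X_init x0_dom X_step Lambda intro: prox_in_dom lam_pos)
  have X_step': "X (Suc k) \<omega> = P (lamp k) (X k \<omega> + \<alpha> k *\<^sub>R D k \<omega> - lamp k *\<^sub>R Vp k \<omega>)"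
    if "\<omega> \<in> space M" for k \<omega>
    using lam_pos(2)[of k] that by (simp add: X_step Lambda matrix_inv_scaled_mult)
  \<comment> \<open>By definition \<open>filt_prev\<close> at \<open>Suc k\<close> is
    \<open>filt_plus\<close> at \<open>k\<close>, the first stage at which \<open>Vp k\<close> is
    known.\<close>
  have Xm: "X k \<in> borel_measurable (filt_prev M V Vp k)" for k
  proof (induction k)
    case 0
    have "(\<lambda>_. x0) \<in> borel_measurable (filt_prev M V Vp 0)" by simp
    then show ?case
      using measurable_cong[of "filt_prev M V Vp 0" "X 0" "\<lambda>_. x0" borel] X_init by simp
  next
    case (Suc k)
    note P_meas = measurable_lipschitz[OF prox_lipschitz[OF lam_pos(2)[of k]]]
    note sub = subalgebra_filt_plus[of M V Vp k]
    note [measurable] = measurable_from_subalg[OF sub measurable_from_subalg[OF subalgebra_filt_prev Suc]]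
      measurable_from_subalg[OF sub B1] measurable_filt_plus[of Vp k M V] P_meas
    have "(\<lambda>\<omega>. P (lamp k) (X k \<omega> + \<alpha> k *\<^sub>R D k \<omega> - lamp k *\<^sub>R Vp k \<omega>)) \<in> borel_measurable (filt_plus M V Vp k)"
      by measurable
    then show ?case
      using X_step' measurable_cong[of "filt_plus M V Vp k" "X (Suc k)"
          "\<lambda>\<omega>. P (lamp k) (X k \<omega> + \<alpha> k *\<^sub>R D k \<omega> - lamp k *\<^sub>R Vp k \<omega>)" borel]
      by (simp add: filt_prev_def)
  qed
  note step = stochastic_extra_step[OF F subalgebra_filt_prev Xm _ dom measurable_filt V_rv(2) B1
      Z_step X_step' steps_nonneg lam_pos step_bounds(1) rho(1,2) step_bounds(2)
      B2(2)[unfolded Lambda prox_residual_scaled[OF lam_pos(1)]] B3_mean B3_var(3,4)]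
  have XL: "L2 (X k)" for k
  proof (induction k)
    case 0
    then show ?case using L2_cong[of "X 0" "\<lambda>_. x0"] X_init L2_const by simp
  next
    case (Suc k)
    then show ?case by (rule step(1))
  qed
  define dX where "dX k \<omega> = norm (X (Suc k) \<omega> - X k \<omega>)" for k \<omega>
  define R where "R k \<omega> = norm (res (X k \<omega>))" for k \<omega>
  have dXint: "integrable M (\<lambda>\<omega>. (dX k \<omega>)\<^sup>2)" for k
    unfolding dX_def by (intro L2_integrable L2_diff XL)
  have resL: "L2 (\<lambda>\<omega>. res (X k \<omega>))" for k
    by (rule L2_lipschitz[OF residual_lipschitz[OF A1(2)] XL])
  have Rint: "integrable M (\<lambda>\<omega>. (R k \<omega>)\<^sup>2)" for k
    unfolding R_def by (intro L2_integrable resL)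
  define N where "N k = lamp k * (\<sigma>p k)\<^sup>2 + 2 * (lam k * (\<sigma> k)\<^sup>2)" for k
  define S where "S k = rho_bar / (2 * lamp k) * expectation (\<lambda>\<omega>. (dX k \<omega>)\<^sup>2) + lam k / 4 * expectation (\<lambda>\<omega>. (R k \<omega>)\<^sup>2)" for k
  have "\<exists>T. integrable M T \<and> (\<forall>\<omega>\<in>space M. psi (X (Suc k) \<omega>) - psi (X k \<omega>) \<le> T \<omega>) \<and>
      expectation T \<le> N k - S k" for k
    using step(2)[OF XL, of k] by (simp add: N_def S_def dX_def R_def algebra_simps)
  then obtain T where T: "\<And>k. integrable M (T k)"
    "\<And>k \<omega>. \<omega> \<in> space M \<Longrightarrow> psi (X (Suc k) \<omega>) - psi (X k \<omega>) \<le> T k \<omega>"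
    "\<And>k. expectation (T k) \<le> N k - S k"
    by metis
  obtain m :: real where m: "\<And>y. y \<in> eff_dom \<phi> \<Longrightarrow> ereal m \<le> ereal (f y) + \<phi> y"
    using A2 by auto
  have mX: "m \<le> psi (X k \<omega>)" if "\<omega> \<in> space M" for k \<omega>
    using m[OF dom[OF that, of k]] phi_eq_h[OF dom[OF that, of k]] by simp
  have S_nonneg: "0 \<le> S k" for k
    using rho lam_pos[of k] less_imp_le[OF lam_pos(1)[of k]] less_imp_le[OF lam_pos(2)[of k]]
    by (auto simp: S_def intro!: add_nonneg_nonneg mult_nonneg_nonneg divide_nonneg_nonneg)
  have N_sum: "summable N" unfolding N_def using sums by (intro summable_add summable_mult)
  have N_nonneg: "0 \<le> N k" for k
    using lam_pos[of k] less_imp_le[OF lam_pos(1)[of k]] less_imp_le[OF lam_pos(2)[of k]]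
    by (auto simp: N_def intro!: add_nonneg_nonneg mult_nonneg_nonneg)
  \<comment> \<open>Along each path the increments of \<open>psi\<close> telescope between the
    constant \<open>psi x0\<close> and a value of at least \<open>m\<close>; only the sum of the
    majorants \<open>T k\<close> is integrated.\<close>
  have "(\<Sum>k<n. S k) \<le> psi x0 - m + suminf N" for n
  proof -
    have "m - psi x0 \<le> (\<Sum>k<n. T k \<omega>)" if \<omega>: "\<omega> \<in> space M" for \<omega>
    proof -
      have "m - psi x0 \<le> psi (X n \<omega>) - psi (X 0 \<omega>)" using mX[OF \<omega>] X_init[OF \<omega>] by simp
      also have "\<dots> = (\<Sum>k<n. psi (X (Suc k) \<omega>) - psi (X k \<omega>))"
        by (rule sum_lessThan_telescope[symmetric])
      also have "\<dots> \<le> (\<Sum>k<n. T k \<omega>)" by (intro sum_mono T \<omega>)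
      finally show ?thesis .
    qed
    then have "expectation (\<lambda>_. m - psi x0) \<le> expectation (\<lambda>\<omega>. \<Sum>k<n. T k \<omega>)"
      using T(1) by (intro integral_mono) auto
    then have "m - psi x0 \<le> (\<Sum>k<n. expectation (T k))"
      using T(1) by (simp add: prob_space)
    also have "\<dots> \<le> (\<Sum>k<n. N k - S k)" by (intro sum_mono T)
    also have "\<dots> = (\<Sum>k<n. N k) - (\<Sum>k<n. S k)" by (rule sum_subtractf)
    also have "(\<Sum>k<n. N k) \<le> suminf N" by (intro sum_le_suminf N_sum) (auto simp: N_nonneg)
    finally show ?thesis by simp
  qed
  then have S_sum: "summable S"
    by (intro summableI_nonneg_bounded[OF S_nonneg])

  \<comment> \<open>The weights \<open>lam k\<close> and \<open>1 / lam k\<close> are dual, so that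
    by Young's inequality \<open>2 * R k \<omega> * dX k \<omega>\<close> is at most
    \<open>Y k \<omega>\<close>.\<close>
  define Y where "Y k \<omega> = lam k * (R k \<omega>)\<^sup>2 + (dX k \<omega>)\<^sup>2 / lam k" for k \<omega>
  have Y_nonneg: "0 \<le> Y k \<omega>" for k \<omega>
    using lam_pos(1)[of k] by (simp add: Y_def)
  have Y_int: "integrable M (Y k)" for k
    unfolding Y_def[abs_def] using dXint Rint by simp
  \<comment> \<open>The 4 undoes the factor \<open>lam k / 4\<close> in \<open>S k\<close>; the
    other summand undoes \<open>rho_bar / (2 * lamp k)\<close> after \<open>1 / lam k\<close> is
    bounded by \<open>1 / (rho_low * lamp k)\<close>.\<close>
  define K where "K = 4 + 2 / (rho_bar * rho_low)"
  have EY: "expectation (Y k) = lam k * expectation (\<lambda>\<omega>. (R k \<omega>)\<^sup>2) + expectation (\<lambda>\<omega>. (dX k \<omega>)\<^sup>2) / lam k" for k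
    unfolding Y_def[abs_def] using dXint Rint by simp
  have EY_le: "expectation (Y k) \<le> K * S k" for k
  proof -
    define a b where "a = lam k / 4 * expectation (\<lambda>\<omega>. (R k \<omega>)\<^sup>2)"
      and "b = rho_bar / (2 * lamp k) * expectation (\<lambda>\<omega>. (dX k \<omega>)\<^sup>2)"
    have ab: "0 \<le> a" "0 \<le> b"
      using rho lam_pos[of k] less_imp_le[OF lam_pos(1)[of k]] less_imp_le[OF lam_pos(2)[of k]]
      by (auto simp: a_def b_def intro!: mult_nonneg_nonneg divide_nonneg_nonneg)
    have "1 / lam k \<le> 1 / (rho_low * lamp k)"
      using rho lam_pos[of k] step_bounds(3)[of k] lam_pos(2)[of k] by (intro divide_left_mono) auto
    then have "expectation (\<lambda>\<omega>. (dX k \<omega>)\<^sup>2) * (1 / lam k) \<le> expectation (\<lambda>\<omega>. (dX k \<omega>)\<^sup>2) * (1 / (rho_low * lamp k))"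
      by (intro mult_left_mono) auto
    also have "\<dots> = 2 / (rho_bar * rho_low) * b"
      using rho lam_pos(2)[of k] by (simp add: b_def field_simps)
    finally have "expectation (Y k) \<le> 4 * a + 2 / (rho_bar * rho_low) * b"
      by (simp add: EY a_def)
    also have "\<dots> \<le> K * (a + b)"
    proof -
      have "0 \<le> 2 / (rho_bar * rho_low) * a" using ab rho by simp
      then show ?thesis using ab unfolding K_def ring_distribs by linarith
    qed
    finally show ?thesis by (simp add: S_def a_def b_def algebra_simps)
  qed
  have EY_sum: "summable (\<lambda>k. expectation (Y k))"
    by (rule summable_comparison_test'[OF summable_mult[OF S_sum, of K], of 0])
      (use EY_le Y_nonneg in \<open>auto simp: abs_of_nonneg integral_nonneg_AE\<close>)
  have Y_sum: "AE \<omega> in M. summable (\<lambda>k. Y k \<omega>)"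
    by (rule AE_summable_of_summable_integral[OF Y_int Y_nonneg EY_sum])
  define C where "C = 2 + Lf"
  have diff: "\<bar>(R (Suc k) \<omega>)\<^sup>2 - (R k \<omega>)\<^sup>2\<bar> \<le> (C + C\<^sup>2) * Y k \<omega>" for k \<omega>
  proof -
    define u w e where "u = R k \<omega>" and "w = R (Suc k) \<omega>" and "e = dX k \<omega>"
    have nn: "0 \<le> u" "0 \<le> w" "0 \<le> e" "0 \<le> C" using A1(1) by (auto simp: u_def w_def e_def R_def dX_def C_def)
    have "\<bar>w - u\<bar> \<le> norm (res (X (Suc k) \<omega>) - res (X k \<omega>))"
      unfolding u_def w_def R_def by (rule norm_triangle_ineq3)
    also have "\<dots> \<le> C * e"
      using lipschitz_onD[OF residual_lipschitz[OF A1(2)], of "X (Suc k) \<omega>" "X k \<omega>"]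
      by (simp add: dist_norm C_def e_def dX_def)
    finally have wu: "\<bar>w - u\<bar> \<le> C * e" .
    have "\<bar>w\<^sup>2 - u\<^sup>2\<bar> = \<bar>w - u\<bar> * (w + u)"
      using nn by (simp add: power2_eq_square square_diff_square_factored abs_mult)
    \<comment> \<open>\<open>w\<close> is eliminated because \<open>Y k\<close> contains the
      residual only at index \<open>k\<close>.\<close>
    also have "\<dots> \<le> (C * e) * (2 * u + C * e)"
      using wu nn by (intro mult_mono) auto
    also have "\<dots> = C * (2 * u * e) + C\<^sup>2 * e\<^sup>2"
      by (simp add: algebra_simps power2_eq_square)
    also have "\<dots> \<le> C * Y k \<omega> + C\<^sup>2 * Y k \<omega>"
    proof (intro add_mono mult_left_mono)
      show "2 * u * e \<le> Y k \<omega>"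
      proof -
        have "2 * (lam k * u) * e \<le> (lam k * u)\<^sup>2 + e\<^sup>2" by (rule sum_squares_bound)
        then show ?thesis
          using lam_pos(1)[of k] by (simp add: Y_def u_def e_def field_simps power2_eq_square)
      qed
      show "e\<^sup>2 \<le> Y k \<omega>"
      proof -
        have "e\<^sup>2 * 1 \<le> e\<^sup>2 * (1 / lam k)"
          using lam1[of k] lam_pos(1)[of k] by (intro mult_left_mono) auto
        then show ?thesis
          using lam_pos(1)[of k] by (simp add: Y_def e_def add_increasing)
      qed
    qed (use nn in auto)
    finally show ?thesis
      by (simp add: u_def w_def algebra_simps)
  qed
  have lR: "lam k * (R k \<omega>)\<^sup>2 \<le> Y k \<omega>" for k \<omega>
    using lam_pos(1)[of k] by (simp add: Y_def)
  have "AE \<omega> in M. (\<lambda>k. res (X k \<omega>)) \<longlonglongrightarrow> 0"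
    using Y_sum
  proof eventually_elim
    case (elim \<omega>)
    \<comment> \<open>Squares are used because their increments, unlike those of the norm, are
      dominated by \<open>Y k\<close>.\<close>
    have "(\<lambda>k. (R k \<omega>)\<^sup>2) \<longlonglongrightarrow> 0"
    proof (rule summable_weighted_imp_tendsto_zero[OF _ _ _ _ sums(1)])
      show "summable (\<lambda>k. lam k * (R k \<omega>)\<^sup>2)"
        by (rule summable_comparison_test'[OF elim, of 0])
          (use lR less_imp_le[OF lam_pos(1)] in \<open>auto simp: abs_mult\<close>)
      show "summable (\<lambda>k. \<bar>(R (Suc k) \<omega>)\<^sup>2 - (R k \<omega>)\<^sup>2\<bar>)"
        by (rule summable_comparison_test'[OF summable_mult[OF elim, of "C + C\<^sup>2"], of 0]) (use diff in auto)
    qed (use less_imp_le[OF lam_pos(1)] in auto)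
    then have "(\<lambda>k. sqrt ((R k \<omega>)\<^sup>2)) \<longlonglongrightarrow> sqrt 0" by (rule tendsto_real_sqrt)
    then show ?case by (simp add: R_def tendsto_norm_zero_iff)
  qed
  \<comment> \<open>The same criterion, applied to the second moments; the first moments follow by
    Jensen's inequality.\<close>
  moreover have "(\<lambda>k. expectation (R k)) \<longlonglongrightarrow> 0"
  proof -
    have "(\<lambda>k. expectation (\<lambda>\<omega>. (R k \<omega>)\<^sup>2)) \<longlonglongrightarrow> 0"
    proof (rule summable_weighted_imp_tendsto_zero[OF _ _ _ _ sums(1)])
      have "lam k * expectation (\<lambda>\<omega>. (R k \<omega>)\<^sup>2) \<le> expectation (Y k)" for k
        using lam_pos(1)[of k] by (simp add: EY)
      then show "summable (\<lambda>k. lam k * expectation (\<lambda>\<omega>. (R k \<omega>)\<^sup>2))"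
        by (intro summable_comparison_test'[OF EY_sum, of 0])
          (use less_imp_le[OF lam_pos(1)] in \<open>auto simp: abs_mult\<close>)
      have "\<bar>expectation (\<lambda>\<omega>. (R (Suc k) \<omega>)\<^sup>2) - expectation (\<lambda>\<omega>. (R k \<omega>)\<^sup>2)\<bar> \<le> (C + C\<^sup>2) * expectation (Y k)" for k
      proof -
        have "\<bar>expectation (\<lambda>\<omega>. (R (Suc k) \<omega>)\<^sup>2) - expectation (\<lambda>\<omega>. (R k \<omega>)\<^sup>2)\<bar>
            = \<bar>expectation (\<lambda>\<omega>. (R (Suc k) \<omega>)\<^sup>2 - (R k \<omega>)\<^sup>2)\<bar>"
          using Rint by simp
        also have "\<dots> \<le> expectation (\<lambda>\<omega>. \<bar>(R (Suc k) \<omega>)\<^sup>2 - (R k \<omega>)\<^sup>2\<bar>)"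
          by (rule integral_abs_bound)
        also have "\<dots> \<le> expectation (\<lambda>\<omega>. (C + C\<^sup>2) * Y k \<omega>)"
          using Rint Y_int diff by (intro integral_mono) auto
        finally show ?thesis by simp
      qed
      then show "summable (\<lambda>k. \<bar>expectation (\<lambda>\<omega>. (R (Suc k) \<omega>)\<^sup>2) - expectation (\<lambda>\<omega>. (R k \<omega>)\<^sup>2)\<bar>)"
        by (intro summable_comparison_test'[OF summable_mult[OF EY_sum, of "C + C\<^sup>2"], of 0]) auto
    qed (use less_imp_le[OF lam_pos(1)] in auto)
    from tendsto_real_sqrt[OF this]
    have lim: "(\<lambda>k. sqrt (expectation (\<lambda>\<omega>. (R k \<omega>)\<^sup>2))) \<longlonglongrightarrow> 0" by simp
    have upper: "expectation (R k) \<le> sqrt (expectation (\<lambda>\<omega>. (R k \<omega>)\<^sup>2))" for k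
      unfolding R_def[abs_def] by (rule expectation_norm_le_sqrt(2)[OF resL])
    have lower: "0 \<le> expectation (R k)" for k
      unfolding R_def[abs_def] by (rule integral_nonneg_AE) simp
    show ?thesis
      by (rule tendsto_sandwich[OF always_eventually always_eventually tendsto_const lim])
        (use lower upper in blast)+
  qed
  moreover have "integrable M (R k)" for k
    unfolding R_def[abs_def] by (rule expectation_norm_le_sqrt(1)[OF resL])
  moreover have prox_residual_one: "prox_residual \<phi> (mat 1) (gradf y) y = res y" for y
    using prox_residual_scaled[of 1 "gradf y" y] by simp
  ultimately show ?thesis
    unfolding prox_residual_one R_def[abs_def] by blast
qed

end
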